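(* Let $\gamma$ denote the Euler–Mascheroni constant. As $x \to \infty$, $$\left|\{\, n \le x : n \ge 3,\ M(n) \neq 0 \,\}\right| \ \ge\ \left(\frac{e^{-\gamma}}{2} + o(1)\right)\frac{x}{\log\log x},$$ where $o(1)$ denotes a quantity tending to $0$ as $x \to \infty$.
   Context: For an integer $n \ge 3$, consider tilings of an $n \times n$ square by finitely many, and at least two, rectangles with integer side lengths which are pairwise incongruent (two rectangles are congruent if they have the same pair of side lengths, up to rotation). The score of such a tiling is the area of its largest rectangle minus the area of its smallest rectangle. $M(n)$ is the minimum score over all such tilings of the $n \times n$ square. *)

theory Defs
  imports "HOL-Analysis.Analysis"
begin

text \<open>Rectangles are axis-parallel closed boxes in the plane. Only the side lengths are required to
  be integers, the corners may be arbitrary real points.\<close>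

definition rect_with_sides :: "(real \<times> real) set \<Rightarrow> nat \<Rightarrow> nat \<Rightarrow> bool" where
  "rect_with_sides R a b \<longleftrightarrow>
     a > 0 \<and> b > 0 \<and> (\<exists>x y. R = cbox (x, y) (x + real a, y + real b))"

definition congruent_rects :: "(real \<times> real) set \<Rightarrow> (real \<times> real) set \<Rightarrow> bool" where
  "congruent_rects R S \<longleftrightarrow>
     (\<exists>a b. rect_with_sides R a b \<and> (rect_with_sides S a b \<or> rect_with_sides S b a))"

definition mondrian_tiling :: "nat \<Rightarrow> (real \<times> real) set set \<Rightarrow> bool" where
  "mondrian_tiling n T \<longleftrightarrow>
     T division_of cbox (0, 0) (real n, real n) \<and>
     card T \<ge> 2 \<and>
     (\<forall>R\<in>T. \<exists>a b. rect_with_sides R a b) \<and>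
     (\<forall>R\<in>T. \<forall>S\<in>T. R \<noteq> S \<longrightarrow> \<not> congruent_rects R S)"

definition tiling_score :: "(real \<times> real) set set \<Rightarrow> real" where
  "tiling_score T = Max (measure lborel ` T) - Min (measure lborel ` T)"

definition mondrian_scores :: "nat \<Rightarrow> real set" where
  "mondrian_scores n = {tiling_score T | T. mondrian_tiling n T}"

text \<open>For \<open>n \<ge> 3\<close> this infimum is a minimum, see \<open>mondrian_M_attained\<close> below.\<close>

definition mondrian_M :: "nat \<Rightarrow> real" where
  "mondrian_M n = Inf (mondrian_scores n)"

lemma content_rect_with_sides:
  assumes "rect_with_sides R a b"
  shows "measure lborel R = real (a * b)"
proof -
  obtain x y where R: "R = cbox (x, y) (x + real a, y + real b)"
    using assms by (auto simp: rect_with_sides_def)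
  have "measure lborel (cbox (x, y) (x + real a, y + real b)) =
      measure lborel (cbox x (x + real a)) * measure lborel (cbox y (y + real b))"
    by (rule content_Pair)
  then show ?thesis by (simp add: R)
qed

lemma rect_with_sides_unique:
  assumes "rect_with_sides R a b" "rect_with_sides R c d"
  shows "c = a" "d = b"
proof -
  obtain x y where R: "R = cbox (x, y) (x + real a, y + real b)"
    using assms by (auto simp: rect_with_sides_def)
  obtain u v where R': "R = cbox (u, v) (u + real c, v + real d)"
    using assms by (auto simp: rect_with_sides_def)
  have "cbox (x, y) (x + real a, y + real b) \<noteq> {}"
    by (simp add: cbox_Pair_eq)
  moreover have "cbox (x, y) (x + real a, y + real b) = cbox (u, v) (u + real c, v + real d)"
    using R R' by simp
  ultimately have "(x, y) = (u, v) \<and> (x + real a, y + real b) = (u + real c, v + real d)"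
    using eq_cbox by metis
  then show "c = a" "d = b" by auto
qed

lemma mondrian_scores_subset_Nats: "mondrian_scores n \<subseteq> \<nat>"
proof
  fix s assume "s \<in> mondrian_scores n"
  then obtain T where s: "s = tiling_score T" and T: "mondrian_tiling n T"
    by (auto simp: mondrian_scores_def)
  have fin: "finite (measure lborel ` T)" and ne: "measure lborel ` T \<noteq> {}"
    using T by (auto simp: mondrian_tiling_def division_of_def)
  have Nats: "measure lborel ` T \<subseteq> \<nat>"
  proof clarify
    fix R assume "R \<in> T"
    then obtain a b where "rect_with_sides R a b"
      using T by (auto simp: mondrian_tiling_def)
    then show "measure lborel R \<in> \<nat>"
      by (metis content_rect_with_sides of_nat_in_Nats)
  qed
  have "Max (measure lborel ` T) \<in> \<nat>" "Min (measure lborel ` T) \<in> \<nat>"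
    using Max_in[OF fin ne] Min_in[OF fin ne] Nats by blast+
  moreover have "Min (measure lborel ` T) \<le> Max (measure lborel ` T)"
    using Min_le[OF fin Max_in[OF fin ne]] .
  ultimately show "s \<in> \<nat>"
    unfolding s tiling_score_def by (rule Nats_diff)
qed

lemma mondrian_scores_nonempty:
  assumes "n \<ge> 3"
  shows "mondrian_scores n \<noteq> {}"
proof -
  define A where "A = cbox (0::real, 0::real) (1, real n)"
  define B where "B = cbox (1::real, 0::real) (real n, real n)"
  have A: "rect_with_sides A 1 n"
    unfolding rect_with_sides_def A_def using assms
    by (intro conjI exI[of _ 0]) auto
  have B: "rect_with_sides B (n - 1) n"
    unfolding rect_with_sides_def B_def using assms
    by (intro conjI exI[of _ "1::real"] exI[of _ "0::real"]) (auto simp: of_nat_diff)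
  have neq: "A \<noteq> B"
    using rect_with_sides_unique[OF A, of "n - 1" n] B assms by auto
  have AB: "\<not> congruent_rects A B" "\<not> congruent_rects B A"
  proof -
    have "a = 1 \<and> b = n" if "rect_with_sides A a b" for a b
      using rect_with_sides_unique[OF A that] by simp
    moreover have "a = n - 1 \<and> b = n" if "rect_with_sides B a b" for a b
      using rect_with_sides_unique[OF B that] by simp
    moreover have "n - 1 \<noteq> 1" "n \<noteq> 1"
      using assms by simp_all
    ultimately show "\<not> congruent_rects A B" "\<not> congruent_rects B A"
      unfolding congruent_rects_def by blast+
  qed
  have "{A, B} division_of cbox (0, 0) (real n, real n)"
  proof (rule division_ofI)
    show "\<Union> {A, B} = cbox (0, 0) (real n, real n)"
      using assms by (auto simp: A_def B_def cbox_Pair_eq)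
    have "(0, 0) \<in> A" "(1, 0) \<in> B"
      using assms by (auto simp: A_def B_def cbox_Pair_eq)
    then show "K \<noteq> {}" if "K \<in> {A, B}" for K
      using that by auto
    show "K \<subseteq> cbox (0, 0) (real n, real n)" if "K \<in> {A, B}" for K
      using that assms by (auto simp: A_def B_def cbox_Pair_eq)
    show "\<exists>a b. K = cbox a b" if "K \<in> {A, B}" for K
      using that by (auto simp: A_def B_def)
    have "interior A \<inter> interior B = {}"
      by (auto simp: A_def B_def box_def Basis_prod_def)
    then show "interior K \<inter> interior L = {}" if "K \<in> {A, B}" "L \<in> {A, B}" "K \<noteq> L" for K L
      using that by auto
  qed auto
  then have "mondrian_tiling n {A, B}"
    unfolding mondrian_tiling_def using neq A B AB by auto
  then show ?thesis by (auto simp: mondrian_scores_def)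
qed

lemma mondrian_M_attained:
  assumes "n \<ge> 3"
  shows "mondrian_M n \<in> mondrian_scores n"
    and "\<And>s. s \<in> mondrian_scores n \<Longrightarrow> mondrian_M n \<le> s"
proof -
  define N where "N = {k::nat. real k \<in> mondrian_scores n}"
  have "N \<noteq> {}"
    using mondrian_scores_nonempty[OF assms] mondrian_scores_subset_Nats[of n]
    by (auto simp: N_def Nats_def)
  then have least: "Inf N \<in> N" by (rule Inf_nat_def1)
  have lower: "real (Inf N) \<le> s" if "s \<in> mondrian_scores n" for s
  proof -
    obtain k where "s = real k"
      using \<open>s \<in> mondrian_scores n\<close> mondrian_scores_subset_Nats[of n] by (auto simp: Nats_def)
    then show ?thesis using that by (auto simp: N_def intro!: wellorder_Inf_le1)
  qed
  have "mondrian_M n = real (Inf N)"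
    unfolding mondrian_M_def using least lower by (intro cInf_eq_minimum) (auto simp: N_def)
  then show "mondrian_M n \<in> mondrian_scores n"
    and "\<And>s. s \<in> mondrian_scores n \<Longrightarrow> mondrian_M n \<le> s"
    using least lower by (auto simp: N_def)
qed

end

(* If M(n) = 0, then all tiles have the same area A, their number k >= 2 satisfies k A = n^2, and
   incongruent tiles of area A have distinct widths, which are divisors of A. Hence k divides n^2 and
   k <= d(n^2), so that n has a prime factor p <= d(n^2). The sum of d(n^2) over n <= x is O(x ln^2 x),
   so with y = (ln x lnln x)^2 all but o(x / lnln x) integers n <= x satisfy d(n^2) < y, and among these
   the ones without prime factors up to y have M(n) /= 0. By Brun's pure sieve there are
   (1 + o(1)) x prod_{p <= y} (1 - 1/p) integers n <= x without prime factors up to y, and by Mertens'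
   third theorem the product is asymptotic to exp(-gamma) / ln y = exp(-gamma) / ((2 + o(1)) lnln x).

   For Mertens' theorem the primes are grouped by the integer part of their logarithm and the sum of
   1/p over a group is compared with the corresponding term of the harmonic series. This is where
   gamma comes from; that the difference has no further constant follows from Abel's limit theorem
   and the simple pole of the zeta function. *)
theory Submission
  imports Defs "HOL-Computational_Algebra.Nth_Powers" "HOL-Computational_Algebra.Primes"
    "HOL-Real_Asymp.Real_Asymp"
begin

section \<open>Chebyshev's bound and Mertens' first theorem\<close>

lemma prod_primes_dvd_iff:
  fixes n :: nat
  assumes "finite D" "\<And>p. p \<in> D \<Longrightarrow> prime p"
  shows "\<Prod>D dvd n \<longleftrightarrow> (\<forall>p\<in>D. p dvd n)"
  using assms
proof (induction D rule: finite_induct)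
  case (insert p D)
  have "coprime p (\<Prod>D)"
    using insert.hyps insert.prems by (intro prod_coprime_right primes_coprime) auto
  then have "p * \<Prod>D dvd n \<longleftrightarrow> p dvd n \<and> \<Prod>D dvd n"
    by (meson divides_mult dvd_mult_left dvd_mult_right)
  then show ?case using insert by simp
qed simp

text \<open>The bound is real so that cut-offs of the form \<open>exp (real K)\<close> need no
  rounding.\<close>

definition primes_le :: "real \<Rightarrow> nat set" where
  "primes_le x = {p. prime p \<and> real p \<le> x}"

lemma finite_primes_le [simp, intro]: "finite (primes_le x)"
proof (rule finite_subset)
  show "primes_le x \<subseteq> {..nat \<lfloor>x\<rfloor>}" by (auto simp: primes_le_def le_nat_floor)
qed auto

lemma primes_le_of_nat: "primes_le (real n) = {p. prime p \<and> p \<le> n}"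
  by (auto simp: primes_le_def)

lemma primes_le_floor: "x \<ge> 0 \<Longrightarrow> primes_le (real (nat \<lfloor>x\<rfloor>)) = primes_le x"
  unfolding primes_le_of_nat by (auto simp: primes_le_def le_nat_iff le_floor_iff)

lemma primes_le_ge_2: "p \<in> primes_le x \<Longrightarrow> real p \<ge> 2"
  by (auto simp: primes_le_def dest: prime_ge_2_nat)

text \<open>Chebyshev's argument: every prime in (n, 2n] divides (2n)! but not n!, hence divides the
  central binomial coefficient, which is at most 4^n.\<close>

lemma theta_double_le:
  "(\<Sum>p\<in>primes_le (real (2 * n)). ln (real p)) \<le> (\<Sum>p\<in>primes_le (real n). ln (real p)) + real n * ln 4"
proof -
  define D where "D = {p. prime p \<and> n < p \<and> p \<le> 2 * n}"
  have finD: "finite D" by (rule finite_subset[of _ "{..2*n}"]) (auto simp: D_def)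
  have "p dvd (2 * n) choose n" if p: "p \<in> D" for p
  proof -
    have "prime p" using p by (auto simp: D_def)
    have "p dvd fact (2 * n)" using p by (auto simp: D_def prime_dvd_fact_iff)
    also have "fact (2 * n) = fact n * fact n * ((2 * n) choose n)"
      using binomial_fact_lemma[of n "2 * n"] by simp
    finally have "p dvd fact n \<or> p dvd ((2 * n) choose n)"
      using \<open>prime p\<close> by (simp add: prime_dvd_mult_iff)
    moreover have "\<not> p dvd fact n" using p by (auto simp: D_def prime_dvd_fact_iff)
    ultimately show ?thesis by blast
  qed
  then have "\<Prod>D dvd (2 * n) choose n"
    by (subst prod_primes_dvd_iff[OF finD]) (auto simp: D_def)
  then have "\<Prod>D \<le> (2 * n) choose n" by (rule dvd_imp_le) simp
  also have "\<dots> \<le> 2 ^ (2 * n)" by (rule binomial_le_pow2)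
  also have "\<dots> = 4 ^ n" by (simp add: power_mult)
  finally have "real (\<Prod>D) \<le> 4 ^ n" by (metis of_nat_le_iff of_nat_numeral of_nat_power)
  moreover have "real (\<Prod>D) > 0"
    by (simp, intro prod_pos) (auto simp: D_def prime_gt_0_nat)
  ultimately have "ln (real (\<Prod>D)) \<le> ln (4 ^ n)" by simp
  moreover have "ln (real (\<Prod>D)) = (\<Sum>p\<in>D. ln (real p))"
    by (simp, rule ln_prod) (use finD in \<open>auto simp: D_def prime_gt_0_nat\<close>)
  ultimately have le: "(\<Sum>p\<in>D. ln (real p)) \<le> real n * ln 4" by (simp add: ln_realpow)
  have "primes_le (real (2 * n)) = primes_le (real n) \<union> D"
    unfolding primes_le_of_nat by (auto simp: D_def)
  then have "(\<Sum>p\<in>primes_le (real (2 * n)). ln (real p)) =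
      (\<Sum>p\<in>primes_le (real n). ln (real p)) + (\<Sum>p\<in>D. ln (real p))"
    by (simp, intro sum.union_disjoint) (use finD in \<open>auto simp: primes_le_of_nat D_def\<close>)
  with le show ?thesis by simp
qed

text \<open>Doubling is iterated through m = ceil(n/2). The constant 3 absorbs the rounding: 3m + m
  = 4m <= 2(n + 1) <= 3n for n >= 2.\<close>

lemma theta_le: "(\<Sum>p\<in>primes_le (real n). ln (real p)) \<le> 3 * ln 4 * real n"
proof (induction n rule: less_induct)
  case (less n)
  show ?case
  proof (cases "n \<le> 1")
    case True
    then have "primes_le (real n) = {}"
      unfolding primes_le_of_nat by (auto dest: prime_gt_1_nat)
    then show ?thesis by simp
  next
    case False
    define m where "m = (n + 1) div 2"
    have m: "m < n" "n \<le> 2 * m" "2 * m \<le> n + 1" using False by (auto simp: m_def)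
    have "(\<Sum>p\<in>primes_le (real n). ln (real p)) \<le> (\<Sum>p\<in>primes_le (real (2 * m)). ln (real p))"
      using m(2) by (intro sum_mono2 finite_primes_le) (auto simp: primes_le_def dest: prime_gt_0_nat)
    also have "\<dots> \<le> (\<Sum>p\<in>primes_le (real m). ln (real p)) + real m * ln 4"
      by (rule theta_double_le)
    also have "\<dots> \<le> 3 * ln 4 * real m + real m * ln 4" using less.IH[OF m(1)] by linarith
    also have "\<dots> = 2 * ln 4 * (2 * real m)" by simp
    also have "\<dots> \<le> 2 * ln 4 * (real n + 1)" using m(3) by (intro mult_left_mono) auto
    also have "\<dots> \<le> 2 * ln 4 * (3 / 2 * real n)" using False by (intro mult_left_mono) auto
    finally show ?thesis by linarith
  qed
qed

text \<open>Legendre's formula in recursive form: the multiples of p up to n contribute one factor p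
  each, and after division by p they run through 1, ..., \<open>n div p\<close>. The induction on n
  only has to treat the case that p divides n + 1.\<close>

lemma multiplicity_fact_rec:
  fixes p :: nat assumes p: "prime p"
  shows "multiplicity p (fact n) = n div p + multiplicity p (fact (n div p))"
proof (induction n)
  case (Suc n)
  have "multiplicity p (fact (Suc n)) = multiplicity p (Suc n) + multiplicity p (fact n)"
    using p by (simp add: prime_elem_multiplicity_mult_distrib del: of_nat_Suc mult_Suc)
  also have "\<dots> = multiplicity p (Suc n) + n div p + multiplicity p (fact (n div p))"
    using Suc.IH by simp
  also have "\<dots> = Suc n div p + multiplicity p (fact (Suc n div p))"
  proof (cases "p dvd Suc n")
    case False
    then show ?thesis by (simp add: div_Suc not_dvd_imp_multiplicity_0 dvd_eq_mod_eq_0)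
  next
    case True
    then obtain q where q: "Suc n = p * q" by blast
    have "q > 0" using q by (cases q) auto
    then obtain q' where q': "q = Suc q'" by (cases q) auto
    have "Suc n div p = q" using q p prime_gt_0_nat by simp
    moreover have "n div p = q'"
      using True \<open>Suc n div p = q\<close> q' by (simp add: div_Suc dvd_eq_mod_eq_0)
    moreover have "multiplicity p (p * q) = 1 + multiplicity p q"
      using p \<open>q > 0\<close> by (simp add: prime_elem_multiplicity_mult_distrib)
    moreover have "multiplicity p (fact q :: nat) = multiplicity p q + multiplicity p (fact q' :: nat)"
      unfolding q' using p by (simp add: prime_elem_multiplicity_mult_distrib del: of_nat_Suc mult_Suc)
    ultimately show ?thesis using q q' by simp
  qed
  finally show ?case .
qed simp

text \<open>The bound is the geometric series n/p + n/p^2 + ...; it reproduces itself under the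
  recursion because 1 + 1/(p - 1) = p/(p - 1).\<close>

lemma multiplicity_fact_le:
  fixes p :: nat assumes p: "prime p"
  shows "real (multiplicity p (fact n)) \<le> real n / (real p - 1)"
proof (induction n rule: less_induct)
  case (less n)
  have p2: "real p \<ge> 2" using prime_ge_2_nat[OF p] by simp
  show ?case
  proof (cases "n = 0")
    case False
    have "real (multiplicity p (fact n)) = real (n div p) + real (multiplicity p (fact (n div p)))"
      by (subst multiplicity_fact_rec[OF p]) simp
    also have "\<dots> \<le> real (n div p) + real (n div p) / (real p - 1)"
      using less.IH[of "n div p"] False prime_gt_1_nat[OF p] by simp
    also have "\<dots> = real (n div p) * real p / (real p - 1)" using p2 by (simp add: field_simps)
    also have "\<dots> \<le> real n / (real p - 1)"
    proof (rule divide_right_mono)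
      show "real (n div p) * real p \<le> real n"
        by (metis div_times_less_eq_dividend of_nat_le_iff of_nat_mult)
    qed (use p2 in auto)
    finally show ?thesis .
  qed (use p2 in auto)
qed

section \<open>The logarithm of the factorial and Mertens' first theorem\<close>

lemma ln_fact_eq_sum_primes:
  "ln (fact n) = (\<Sum>p\<in>primes_le (real n). real (multiplicity p (fact n)) * ln (real p))"
proof -
  have "prime_factors (fact n) = primes_le (real n)"
    unfolding primes_le_of_nat by (auto simp: prime_factors_dvd prime_dvd_fact_iff)
  then have "(fact n :: nat) = (\<Prod>p\<in>primes_le (real n). p ^ multiplicity p (fact n))"
    using prime_factorization_nat[of "fact n"] by simp
  then have "(fact n :: real) = (\<Prod>p\<in>primes_le (real n). real p ^ multiplicity p (fact n))"
    by (metis (mono_tags, lifting) of_nat_fact of_nat_power of_nat_prod prod.cong)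
  also have "ln \<dots> = (\<Sum>p\<in>primes_le (real n). ln (real p ^ multiplicity p (fact n)))"
    by (rule ln_prod) (auto simp: primes_le_def prime_gt_0_nat)
  also have "\<dots> = (\<Sum>p\<in>primes_le (real n). real (multiplicity p (fact n)) * ln (real p))"
    by (intro sum.cong refl) (auto simp: ln_realpow primes_le_def prime_gt_0_nat)
  finally show ?thesis .
qed

lemma ln_fact_ge: "n > 0 \<Longrightarrow> ln (fact n) \<ge> real n * ln (real n) - real n"
proof (induction n rule: nat_induct_non_zero)
  case (Suc n)
  have "ln (1 + 1 / real n) \<le> 1 / real n" by (rule ln_add_one_self_le_self) simp
  also have "1 + 1 / real n = real (Suc n) / real n" using Suc by (simp add: field_simps)
  finally have "real n * (ln (real (Suc n)) - ln (real n)) \<le> 1"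
    using Suc by (simp add: ln_div field_simps)
  moreover have "ln (fact (Suc n)) = ln (real (Suc n)) + ln (fact n)"
    by (simp add: ln_mult del: of_nat_Suc)
  ultimately show ?case using Suc by (simp add: algebra_simps)
qed simp

text \<open>This is the cost of replacing 1/(p - 1) by 1/p in \<open>mertens_first\<close>. The
  estimate ln p <= 2 sqrt p reduces it to the convergent series of k^(-3/2).\<close>

lemma sum_ln_over_primes_bounded:
  "\<exists>C. \<forall>x. (\<Sum>p\<in>primes_le x. ln (real p) / (real p * (real p - 1))) \<le> C"
proof (intro exI allI)
  fix x
  have s: "summable (\<lambda>k. 4 * real k powr (-3/2))"
    by (intro summable_mult) (simp add: summable_real_powr_iff)
  have "(\<Sum>p\<in>primes_le x. ln (real p) / (real p * (real p - 1))) \<le>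
      (\<Sum>p\<in>primes_le x. 4 * real p powr (-3/2))"
  proof (rule sum_mono)
    fix p assume "p \<in> primes_le x"
    then have p: "real p \<ge> 2" by (rule primes_le_ge_2)
    have "ln (real p) = 2 * ln (sqrt (real p))" using p by (simp add: ln_sqrt)
    also have "\<dots> \<le> 2 * sqrt (real p)" using p ln_le_minus_one[of "sqrt (real p)"] by simp
    finally have "ln (real p) / (real p * (real p - 1)) \<le> 2 * sqrt (real p) / (real p * (real p / 2))"
      using p by (intro frac_le mult_left_mono) auto
    also have "\<dots> = 4 * (real p powr (1/2) / real p powr 2)"
      using p by (simp add: powr_half_sqrt power2_eq_square)
    also have "\<dots> = 4 * real p powr (-3/2)" by (subst powr_diff[symmetric]) simp
    finally show "ln (real p) / (real p * (real p - 1)) \<le> 4 * real p powr (-3/2)" .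
  qed
  also have "\<dots> \<le> (\<Sum>k. 4 * real k powr (-3/2))"
    by (rule sum_le_suminf[OF s]) auto
  finally show "(\<Sum>p\<in>primes_le x. ln (real p) / (real p * (real p - 1))) \<le> (\<Sum>k. 4 * real k powr (-3/2))" .
qed

text \<open>ln(n!) is computed twice: as n ln n + O(n), and as a sum over primes by Legendre's
  formula. After division by n the difference is bounded.\<close>

theorem mertens_first:
  "\<exists>C. \<forall>n>0. \<bar>(\<Sum>p\<in>primes_le (real n). ln (real p) / real p) - ln (real n)\<bar> \<le> C"
proof -
  obtain C where C: "\<And>x. (\<Sum>p\<in>primes_le x. ln (real p) / (real p * (real p - 1))) \<le> C"
    using sum_ln_over_primes_bounded by blast
  show ?thesis
  proof (intro exI[of _ "max (C + 1) (3 * ln 4)"] allI impI)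
    fix n :: nat assume n: "n > 0"
    let ?P = "primes_le (real n)" and ?L = "\<Sum>p\<in>primes_le (real n). ln (real p) / real p"
    have "real n * ln (real n) - real n \<le> ln (fact n)" by (rule ln_fact_ge[OF n])
    also have "\<dots> \<le> (\<Sum>p\<in>?P. real n / (real p - 1) * ln (real p))"
      unfolding ln_fact_eq_sum_primes
      by (intro sum_mono mult_right_mono multiplicity_fact_le)
        (auto simp: primes_le_def dest: prime_gt_0_nat)
    also have "\<dots> = (\<Sum>p\<in>?P. real n * (ln (real p) / real p + ln (real p) / (real p * (real p - 1))))"
    proof (rule sum.cong[OF refl])
      fix p assume "p \<in> ?P"
      then have "real p \<ge> 2" by (rule primes_le_ge_2)
      then show "real n / (real p - 1) * ln (real p) =
          real n * (ln (real p) / real p + ln (real p) / (real p * (real p - 1)))"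
        by (simp add: divide_simps) (simp add: algebra_simps)
    qed
    also have "\<dots> \<le> real n * (?L + C)"
      unfolding sum_distrib_left[symmetric] sum.distrib using C[of "real n"]
      by (intro mult_left_mono) auto
    finally have "real n * (ln (real n) - 1) \<le> real n * (?L + C)" by (simp add: algebra_simps)
    then have lower: "ln (real n) - 1 \<le> ?L + C" using n by simp
    \<comment> \<open>For the other direction the multiplicity of p is at least n/p - 1. The loss of
      ln p for every prime adds up to Chebyshev's theta function, which is O(n).\<close>
    have "real n * ?L - 3 * ln 4 * real n \<le> real n * ?L - (\<Sum>p\<in>?P. ln (real p))"
      using theta_le[of n] by simp
    also have "\<dots> = (\<Sum>p\<in>?P. (real n / real p - 1) * ln (real p))"
      by (simp add: sum_distrib_left sum_subtractf algebra_simps)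
    also have "\<dots> \<le> (\<Sum>p\<in>?P. real (multiplicity p (fact n)) * ln (real p))"
    proof (intro sum_mono mult_right_mono)
      fix p assume p: "p \<in> ?P"
      have "real n / real p - 1 \<le> real (n div p)"
        using real_of_int_floor_gt_diff_one[of "real n / real p"]
        unfolding floor_divide_of_nat_eq by simp
      also have "n div p \<le> multiplicity p (fact n)"
        using multiplicity_fact_rec[of p n] p by (simp add: primes_le_def)
      finally show "real n / real p - 1 \<le> real (multiplicity p (fact n))" by simp
      show "ln (real p) \<ge> 0" using primes_le_ge_2[OF p] by simp
    qed
    also have "\<dots> = ln (fact n)" by (rule ln_fact_eq_sum_primes[symmetric])
    also have "\<dots> \<le> ln (real n ^ n)"
      using fact_le_power[of n, where ?'a = real] n by (subst ln_le_cancel_iff) auto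
    also have "\<dots> = real n * ln (real n)" using n by (simp add: ln_realpow)
    finally have "real n * (?L - 3 * ln 4) \<le> real n * ln (real n)" by (simp add: algebra_simps)
    then have "?L - 3 * ln 4 \<le> ln (real n)" using n by simp
    with lower show "\<bar>?L - ln (real n)\<bar> \<le> max (C + 1) (3 * ln 4)" by linarith
  qed
qed

section \<open>Euler products and Abel's limit theorem\<close>

text \<open>A discrete comparison with the integral of t^(-1 - \<delta>). With x = n + 1 the
  inequality 1 + \<delta>/x <= (1 - 1/x)^(-\<delta>) bounds each new term by a telescoping
  difference.\<close>

lemma sum_powr_le:
  fixes \<delta> :: real assumes "\<delta> > 0" "M > 0"
  shows "(\<Sum>n=1..M. real n powr (-1 - \<delta>)) \<le> 1 + (1 - real M powr (-\<delta>)) / \<delta>"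
  using assms(2)
proof (induction M rule: nat_induct_non_zero)
  case (Suc n)
  define x where "x = real (Suc n)"
  have x: "x > 1" "real n = x * (1 - 1 / x)" using Suc by (auto simp: x_def field_simps)
  have "1 + \<delta> / x \<le> 1 - \<delta> * ln (1 - 1 / x)"
  proof -
    have "ln (1 - 1 / x) \<le> - (1 / x)" using ln_le_minus_one[of "1 - 1 / x"] x by simp
    then have "\<delta> * ln (1 - 1 / x) \<le> \<delta> * (- (1 / x))"
      using assms(1) by (intro mult_left_mono) auto
    then show ?thesis by simp
  qed
  also have "\<dots> \<le> exp (- \<delta> * ln (1 - 1 / x))"
    using exp_ge_add_one_self[of "- \<delta> * ln (1 - 1 / x)"] by simp
  also have "\<dots> = (1 - 1 / x) powr (-\<delta>)" using x by (simp add: powr_def)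
  finally have "x powr (-\<delta>) * (1 + \<delta> / x) \<le> x powr (-\<delta>) * (1 - 1 / x) powr (-\<delta>)"
    by (rule mult_left_mono) simp
  also have "\<dots> = real n powr (-\<delta>)" unfolding x(2) using x(1) by (subst powr_mult) auto
  finally have "x powr (-\<delta>) * \<delta> / x \<le> real n powr (-\<delta>) - x powr (-\<delta>)"
    by (simp add: algebra_simps)
  moreover have "x powr (-1 - \<delta>) = x powr (-\<delta>) / x"
    using x by (simp add: powr_diff powr_minus field_simps)
  ultimately have "x powr (-1 - \<delta>) \<le> (real n powr (-\<delta>) - x powr (-\<delta>)) / \<delta>"
    using assms(1) by (simp add: field_simps)
  then show ?case using Suc.IH by (simp add: x_def diff_divide_distrib)
qed simp

text \<open>A bound for zeta(1 + \<delta>), in terms of unconditional sums so that the index set can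
  be split freely in the Euler product.\<close>

lemma infsum_powr_le:
  fixes \<delta> :: real assumes \<delta>: "\<delta> > 0"
  shows "(\<lambda>n. real n powr (-1 - \<delta>)) summable_on {0<..}"
    and "infsum (\<lambda>n. real n powr (-1 - \<delta>)) {0<..} \<le> 1 + 1 / \<delta>"
proof -
  have bound: "(\<Sum>n\<in>F. real n powr (-1 - \<delta>)) \<le> 1 + 1 / \<delta>" if F: "finite F" "F \<subseteq> {0<..}" for F
  proof -
    define M where "M = Max (insert 1 F)"
    have "1 \<le> M" unfolding M_def by (rule Max_ge) (use F in auto)
    then have "M > 0" by simp
    have "F \<subseteq> {1..M}"
      using F Max_ge[of "insert 1 F"] by (auto simp: M_def Suc_le_eq)
    then have "(\<Sum>n\<in>F. real n powr (-1 - \<delta>)) \<le> (\<Sum>n=1..M. real n powr (-1 - \<delta>))"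
      by (intro sum_mono2) auto
    also have "\<dots> \<le> 1 + (1 - real M powr (-\<delta>)) / \<delta>" by (rule sum_powr_le) fact+
    also have "\<dots> \<le> 1 + 1 / \<delta>" using \<delta> by (simp add: divide_right_mono)
    finally show ?thesis .
  qed
  show summable: "(\<lambda>n. real n powr (-1 - \<delta>)) summable_on {0<..}"
    by (rule nonneg_bdd_above_summable_on) (use bound in \<open>auto intro!: bdd_aboveI2\<close>)
  show "infsum (\<lambda>n. real n powr (-1 - \<delta>)) {0<..} \<le> 1 + 1 / \<delta>"
    by (rule infsum_le_finite_sums[OF summable bound])
qed

text \<open>Induction on \<open>P\<close>: the positive integers free of \<open>P\<close> are the
  disjoint union of those also free of a new prime q and of q times those free of \<open>P\<close>.
  As \<open>f\<close> is multiplicative, removing the second set multiplies the sum by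
  \<open>1 - f q\<close>.\<close>

lemma infsum_coprime_eq_euler_product:
  fixes \<delta> :: real and P :: "nat set"
  assumes \<delta>: "\<delta> > 0" and P: "finite P" "\<And>p. p \<in> P \<Longrightarrow> prime p"
  defines "f \<equiv> (\<lambda>n::nat. real n powr (-1 - \<delta>))"
  shows "infsum f {n. n > 0 \<and> (\<forall>p\<in>P. \<not> p dvd n)} = infsum f {0<..} * (\<Prod>p\<in>P. 1 - f p)"
  using P
proof (induction P rule: finite_induct)
  case empty
  then show ?case by (simp add: greaterThan_def)
next
  case (insert q P)
  define A where "A = {n. n > 0 \<and> (\<forall>p\<in>P. \<not> p dvd n)}"
  define B where "B = {n. n > 0 \<and> (\<forall>p\<in>insert q P. \<not> p dvd n)}"
  have sum: "f summable_on X" if "X \<subseteq> {0<..}" for X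
    using infsum_powr_le(1)[OF \<delta>] that unfolding f_def by (rule summable_on_subset_banach)
  have q: "prime q" "q > 0" using insert.prems by (auto simp: prime_gt_0_nat)
  have cop: "\<not> p dvd q" if "p \<in> P" for p
    using that insert primes_dvd_imp_eq[of p q] by auto
  have "A = B \<union> (\<lambda>n. q * n) ` A"
  proof (intro equalityI subsetI)
    fix n assume n: "n \<in> A"
    show "n \<in> B \<union> (\<lambda>n. q * n) ` A"
    proof (cases "q dvd n")
      case True
      then obtain k where k: "n = q * k" by blast
      then have "k \<in> A" using n by (auto simp: A_def)
      then show ?thesis using k by blast
    qed (use n in \<open>auto simp: A_def B_def\<close>)
  next
    fix n assume "n \<in> B \<union> (\<lambda>n. q * n) ` A"
    then show "n \<in> A"
    proof
      assume "n \<in> (\<lambda>n. q * n) ` A"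
      then obtain k where k: "n = q * k" "k \<in> A" by blast
      have "\<not> p dvd q * k" if "p \<in> P" for p
        using that cop[OF that] k(2) prime_dvd_multD[of p q k] insert.prems by (auto simp: A_def)
      then show "n \<in> A" using k q by (auto simp: A_def)
    qed (auto simp: A_def B_def)
  qed
  then have "infsum f A = infsum f (B \<union> (\<lambda>n. q * n) ` A)" by simp
  also have "\<dots> = infsum f B + infsum f ((\<lambda>n. q * n) ` A)"
    by (intro infsum_Un_disjoint sum) (use q in \<open>auto simp: A_def B_def\<close>)
  also have "infsum f ((\<lambda>n. q * n) ` A) = infsum (f \<circ> (\<lambda>n. q * n)) A"
    using q by (intro infsum_reindex) (auto simp: inj_on_def)
  also have "\<dots> = infsum (\<lambda>n. f q * f n) A"
    by (simp add: f_def o_def powr_mult)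
  also have "\<dots> = f q * infsum f A"
    by (intro infsum_cmult_right sum) (auto simp: A_def)
  finally have "infsum f B = infsum f A - f q * infsum f A" by linarith
  also have "\<dots> = infsum f A * (1 - f q)" by (simp add: algebra_simps)
  also have "infsum f A = infsum f {0<..} * (\<Prod>p\<in>P. 1 - f p)"
    unfolding A_def by (rule insert.IH) (use insert.prems in auto)
  finally show ?case using insert.hyps by (simp add: B_def mult_ac)
qed

text \<open>The number 1 survives every sieving, so zeta(1 + \<delta>) times the finite product is
  at least 1. It remains to take logarithms and to use zeta(1 + \<delta>) <= 1 + 1/\<delta>.\<close>

lemma sum_ln_euler_factor_le:
  fixes \<delta> :: real and P :: "nat set"
  assumes \<delta>: "\<delta> > 0" and P: "finite P" "\<And>p. p \<in> P \<Longrightarrow> prime p"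
  shows "(\<Sum>p\<in>P. - ln (1 - real p powr (-1 - \<delta>))) \<le> ln (1 + 1 / \<delta>)"
proof -
  define f where "f = (\<lambda>n::nat. real n powr (-1 - \<delta>))"
  let ?A = "{n. n > 0 \<and> (\<forall>p\<in>P. \<not> p dvd n)}"
  have f_less: "f p < 1" if "p \<in> P" for p
  proof -
    have "real p > 1" using P(2)[OF that] prime_gt_1_nat by simp
    then have "real p powr (-1 - \<delta>) < real p powr 0" using \<delta> by (intro powr_less_mono) auto
    then show ?thesis using \<open>real p > 1\<close> by (simp add: f_def)
  qed
  then have pos: "(\<Prod>p\<in>P. 1 - f p) > 0" by (intro prod_pos) auto
  have "1 = (\<Sum>n\<in>{1}. f n)" by (simp add: f_def)
  also have "\<dots> \<le> infsum f ?A"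
  proof (rule finite_sum_le_infsum)
    show "f summable_on ?A"
      using infsum_powr_le(1)[OF \<delta>] unfolding f_def by (rule summable_on_subset_banach) auto
    show "{1} \<subseteq> ?A" using P(2)[of 1] by auto
  qed (auto simp: f_def)
  also have "\<dots> = infsum f {0<..} * (\<Prod>p\<in>P. 1 - f p)"
    unfolding f_def by (rule infsum_coprime_eq_euler_product) fact+
  also have "\<dots> \<le> (1 + 1 / \<delta>) * (\<Prod>p\<in>P. 1 - f p)"
    using infsum_powr_le(2)[OF \<delta>] pos unfolding f_def by (intro mult_right_mono) auto
  finally have "ln 1 \<le> ln ((1 + 1 / \<delta>) * (\<Prod>p\<in>P. 1 - f p))"
    by (subst ln_le_cancel_iff) auto
  also have "\<dots> = ln (1 + 1 / \<delta>) + ln (\<Prod>p\<in>P. 1 - f p)"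
    using pos \<delta> by (intro ln_mult_pos) (auto intro: add_pos_pos)
  also have "ln (\<Prod>p\<in>P. 1 - f p) = (\<Sum>p\<in>P. ln (1 - f p))"
    by (intro ln_prod) (auto simp: P(1) dest: f_less)
  finally show ?thesis by (simp add: f_def sum_negf)
qed

section \<open>The logarithmic series, Abel's limit theorem and a Dirichlet test\<close>

lemma sums_ln_one_minus:
  fixes z :: real assumes "\<bar>z\<bar> < 1"
  shows "(\<lambda>j. z ^ Suc j / real (Suc j)) sums (- ln (1 - z))"
proof -
  have "(\<lambda>n. - (z ^ n) / real n) sums ln (1 - z)"
    using ln_series'[of "-z"] assms by simp
  then have "(\<lambda>n. z ^ n / real n) sums (- ln (1 - z))" using sums_minus by fastforce
  then show ?thesis using sums_Suc_iff[of "\<lambda>n. z ^ n / real n" "- ln (1 - z)"] by simp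
qed

theorem abel_limit:
  fixes a :: "nat \<Rightarrow> real"
  assumes a: "summable a"
  shows "((\<lambda>z. \<Sum>j. a j * z ^ j) \<longlongrightarrow> suminf a) (at_left 1)"
proof -
  define S where "S = suminf a"
  define T where "T = (\<lambda>n. \<Sum>j<n. a j)"
  have T: "T \<longlonglongrightarrow> S"
    unfolding T_def S_def by (rule summable_LIMSEQ[OF a])
  \<comment> \<open>Summation by parts with the partial sums measured from their limit, so that the
    weights (1 - z) z^j meet only small deviations once j is large.\<close>
  have abel: "(\<Sum>j<n. a j * z ^ j) - S =
      (1 - z) * (\<Sum>j<n. (T (Suc j) - S) * z ^ j) + (T n - S) * z ^ n" for z n
    by (induction n) (auto simp: T_def algebra_simps)
  have smm: "summable (\<lambda>j. a j * z ^ j)" if z: "0 < z" "z < 1" for z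
    using powser_inside[of a 1 z] a z by simp
  show ?thesis
    unfolding S_def[symmetric]
  proof (rule tendstoI)
    fix e :: real assume e: "e > 0"
    obtain N where N: "\<And>n. n \<ge> N \<Longrightarrow> \<bar>T n - S\<bar> < e / 2"
      using LIMSEQ_D[OF T, of "e / 2"] e by auto
    \<comment> \<open>\<open>R\<close> collects the deviations of the first \<open>N\<close> partial
      sums and enters with the factor 1 - z. The later ones contribute at most e/2 in total, since
      (1 - z) times a geometric sum is at most 1.\<close>
    define R where "R = (\<Sum>j<N. \<bar>T (Suc j) - S\<bar>)"
    have R: "R \<ge> 0" by (auto simp: R_def intro: sum_nonneg)
    \<comment> \<open>The threshold gives (1 - z)(R + 1) < e/2; the added 1 keeps the denominator
      positive when \<open>R\<close> is 0.\<close>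
    have "eventually (\<lambda>z. z > max 0 (1 - e / (2 * (R + 1)))) (at_left (1::real))"
      using e R by (intro eventually_at_leftI[of "max 0 (1 - e / (2 * (R + 1)))"]) auto
    moreover have "eventually (\<lambda>z. z < 1) (at_left (1::real))"
      by (simp add: eventually_at_filter)
    ultimately show "eventually (\<lambda>z. dist (\<Sum>j. a j * z ^ j) S < e) (at_left 1)"
    proof eventually_elim
      case (elim z)
      then have z: "0 < z" "z < 1" by auto
      have "\<bar>(\<Sum>j<n. a j * z ^ j) - S\<bar> \<le> (1 - z) * R + e / 2 + \<bar>T n - S\<bar> * z ^ n"
        if n: "n \<ge> N" for n
      proof -
        have "\<bar>(\<Sum>j<n. (T (Suc j) - S) * z ^ j)\<bar> \<le> (\<Sum>j<n. \<bar>T (Suc j) - S\<bar> * z ^ j)"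
          using z by (intro order_trans[OF sum_abs]) (auto simp: abs_mult)
        also have "\<dots> \<le> (\<Sum>j<n. (if j < N then \<bar>T (Suc j) - S\<bar> else 0) + e / 2 * z ^ j)"
        proof (rule sum_mono)
          fix j
          show "\<bar>T (Suc j) - S\<bar> * z ^ j \<le> (if j < N then \<bar>T (Suc j) - S\<bar> else 0) + e / 2 * z ^ j"
          proof (cases "j < N")
            case True
            have "\<bar>T (Suc j) - S\<bar> * z ^ j \<le> \<bar>T (Suc j) - S\<bar> * 1"
              using z by (intro mult_left_mono) (auto intro: power_le_one)
            moreover have "e / 2 * z ^ j \<ge> 0" using z e by simp
            ultimately show ?thesis using True by simp
          next
            case False
            then show ?thesis using N[of "Suc j"] z by (auto intro!: mult_right_mono)
          qed
        qed
        also have "\<dots> = R + e / 2 * (\<Sum>j<n. z ^ j)"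
        proof -
          have "(\<Sum>j<n. if j < N then \<bar>T (Suc j) - S\<bar> else 0) = R"
            unfolding R_def using n by (intro sum.mono_neutral_cong_right) auto
          then show ?thesis by (simp add: sum.distrib sum_distrib_left)
        qed
        finally have "(1 - z) * \<bar>(\<Sum>j<n. (T (Suc j) - S) * z ^ j)\<bar> \<le>
            (1 - z) * (R + e / 2 * (\<Sum>j<n. z ^ j))"
          using z by (intro mult_left_mono) auto
        also have "\<dots> = (1 - z) * R + e / 2 * ((1 - z) * (\<Sum>j<n. z ^ j))"
          by (simp only: distrib_left mult.left_commute[of "1 - z" "e / 2"])
        also have "(1 - z) * (\<Sum>j<n. z ^ j) = 1 - z ^ n" by (rule one_diff_power_eq[symmetric])
        also have "e / 2 * (1 - z ^ n) \<le> e / 2 * 1" using z e by (intro mult_left_mono) auto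
        finally have "(1 - z) * \<bar>(\<Sum>j<n. (T (Suc j) - S) * z ^ j)\<bar> \<le> (1 - z) * R + e / 2"
          by simp
        moreover have "\<bar>(\<Sum>j<n. a j * z ^ j) - S\<bar> \<le>
            (1 - z) * \<bar>(\<Sum>j<n. (T (Suc j) - S) * z ^ j)\<bar> + \<bar>T n - S\<bar> * z ^ n"
          unfolding abel using z by (intro order_trans[OF abs_triangle_ineq]) (auto simp: abs_mult)
        ultimately show ?thesis by linarith
      qed
      then have ev: "eventually (\<lambda>n. \<bar>(\<Sum>j<n. a j * z ^ j) - S\<bar> \<le>
          (1 - z) * R + e / 2 + \<bar>T n - S\<bar> * z ^ n) sequentially"
        by (rule eventually_sequentiallyI)
      have l1: "(\<lambda>n. \<bar>(\<Sum>j<n. a j * z ^ j) - S\<bar>) \<longlonglongrightarrow> \<bar>(\<Sum>j. a j * z ^ j) - S\<bar>"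
        by (intro tendsto_intros summable_LIMSEQ smm z)
      have "(\<lambda>n. (1 - z) * R + e / 2 + \<bar>T n - S\<bar> * z ^ n) \<longlonglongrightarrow> (1 - z) * R + e / 2 + \<bar>S - S\<bar> * 0"
        using z by (intro tendsto_intros T LIMSEQ_power_zero) auto
      from tendsto_le[OF _ this l1 ev]
      have "\<bar>(\<Sum>j. a j * z ^ j) - S\<bar> \<le> (1 - z) * R + e / 2" by simp
      also have "(1 - z) * R \<le> (1 - z) * (R + 1)" using z by (intro mult_left_mono) auto
      also have "\<dots> < e / (2 * (R + 1)) * (R + 1)"
        using elim R by (intro mult_strict_right_mono) auto
      also have "\<dots> = e / 2" using R by (simp add: field_simps)
      finally show ?case by (simp add: dist_real_def)
    qed
  qed
qed

text \<open>Dirichlet's test for the weights 1/(j + 1): summation by parts leaves bounded partial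
  sums against the telescoping differences 1/(j + 1) - 1/(j + 2).\<close>

lemma summable_over_Suc:
  fixes b :: "nat \<Rightarrow> real"
  assumes B: "\<And>n. \<bar>\<Sum>j<n. b j\<bar> \<le> C"
  shows "summable (\<lambda>j. b j / real (Suc j))"
proof -
  define B where "B = (\<lambda>n. \<Sum>j<n. b j)"
  have B_le: "\<bar>B n\<bar> \<le> C" for n using assms by (simp add: B_def)
  have abel: "(\<Sum>j<n. b j / real (Suc j)) =
      B n / real (Suc n) + (\<Sum>j<n. B (Suc j) * (1 / real (Suc j) - 1 / real (Suc (Suc j))))" for n
    by (induction n) (auto simp: B_def add_divide_distrib right_diff_distrib)
  have tele: "summable (\<lambda>j. 1 / real (Suc j) - 1 / real (Suc (Suc j)))"
    by (rule telescope_summable'[of _ 0])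
      (use LIMSEQ_inverse_real_of_nat in \<open>simp add: inverse_eq_divide\<close>)
  have "summable (\<lambda>j. B (Suc j) * (1 / real (Suc j) - 1 / real (Suc (Suc j))))"
  proof (rule summable_comparison_test'[of _ 0])
    show "summable (\<lambda>j. C * (1 / real (Suc j) - 1 / real (Suc (Suc j))))"
      by (rule summable_mult[OF tele])
    fix j
    have "1 / real (Suc j) - 1 / real (Suc (Suc j)) \<ge> 0" by (simp add: field_simps)
    then show "norm (B (Suc j) * (1 / real (Suc j) - 1 / real (Suc (Suc j)))) \<le>
        C * (1 / real (Suc j) - 1 / real (Suc (Suc j)))"
      using mult_right_mono[OF B_le] by (simp add: abs_mult)
  qed
  then have "convergent (\<lambda>n. \<Sum>j<n. B (Suc j) * (1 / real (Suc j) - 1 / real (Suc (Suc j))))"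
    by (simp add: summable_iff_convergent)
  moreover have "(\<lambda>n. B n / real (Suc n)) \<longlonglongrightarrow> 0"
  proof (rule Lim_null_comparison)
    show "(\<lambda>n. C * (1 / real (Suc n))) \<longlonglongrightarrow> 0"
      using tendsto_mult_right_zero[OF LIMSEQ_inverse_real_of_nat, of C] by (simp add: inverse_eq_divide)
    show "eventually (\<lambda>n. norm (B n / real (Suc n)) \<le> C * (1 / real (Suc n))) sequentially"
      using B_le by (auto intro!: always_eventually divide_right_mono)
  qed
  then have "convergent (\<lambda>n. B n / real (Suc n))" by (rule convergentI)
  ultimately show ?thesis
    unfolding summable_iff_convergent abel by (intro convergent_add)
qed

section \<open>Mertens' third theorem\<close>

text \<open>On block j >= 1 the value 1 / ln p lies between 1/(j + 1) and 1/j, which makes the block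
  sum of 1/p comparable with the term 1/(j + 1) of the harmonic series.\<close>

definition prime_class :: "nat \<Rightarrow> nat set" where
  "prime_class j = primes_le (exp (real (Suc j))) - primes_le (exp (real j))"

lemma prime_classD:
  assumes "p \<in> prime_class j"
  shows "prime p" "real j < ln (real p)" "ln (real p) \<le> real (Suc j)" "real p \<ge> 2"
proof -
  show p: "prime p" "real p \<ge> 2"
    using assms primes_le_ge_2 by (auto simp: prime_class_def primes_le_def)
  have "exp (real j) < real p" "real p \<le> exp (real (Suc j))"
    using assms by (auto simp: prime_class_def primes_le_def)
  moreover have "exp (ln (real p)) = real p" using p by simp
  ultimately show "real j < ln (real p)" "ln (real p) \<le> real (Suc j)"
    by (metis exp_less_cancel_iff, metis exp_le_cancel_iff)
qed

lemma sum_prime_class: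
  fixes f :: "nat \<Rightarrow> real"
  shows "(\<Sum>j<K. \<Sum>p\<in>prime_class j. f p) = (\<Sum>p\<in>primes_le (exp (real K)). f p)"
proof (induction K)
  case 0
  have "primes_le 1 = {}" using primes_le_ge_2[of _ 1] by (force simp: primes_le_def)
  then show ?case by simp
next
  case (Suc K)
  have "primes_le (exp (real K)) \<subseteq> primes_le (exp (real (Suc K)))"
    by (auto simp: primes_le_def intro: order_trans)
  then have "(\<Sum>p\<in>primes_le (exp (real (Suc K))). f p) =
      (\<Sum>p\<in>primes_le (exp (real (Suc K))) - primes_le (exp (real K)). f p) + (\<Sum>p\<in>primes_le (exp (real K)). f p)"
    by (intro sum.subset_diff) auto
  then show ?case using Suc.IH by (simp add: prime_class_def)
qed

text \<open>Passing from e^K to its integer part leaves the set of primes unchanged and moves the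
  logarithm by at most ln 2.\<close>

lemma mertens_first_exp:
  "\<exists>C. \<forall>K. \<bar>(\<Sum>p\<in>primes_le (exp (real K)). ln (real p) / real p) - real K\<bar> \<le> C"
proof -
  obtain C where C: "\<And>n. n > 0 \<Longrightarrow>
      \<bar>(\<Sum>p\<in>primes_le (real n). ln (real p) / real p) - ln (real n)\<bar> \<le> C"
    using mertens_first by blast
  show ?thesis
  proof (intro exI[of _ "C + ln 2"] allI)
    fix K
    define n where "n = nat \<lfloor>exp (real K)\<rfloor>"
    have e1: "exp (real K) \<ge> 1" by simp
    have "\<lfloor>exp (real K)\<rfloor> \<ge> 1" using e1 by (subst le_floor_iff) simp
    then have n_eq: "real n = of_int \<lfloor>exp (real K)\<rfloor>" and n1: "real n \<ge> 1"
      by (auto simp: n_def)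
    have n: "real n \<le> exp (real K)" "exp (real K) \<le> 2 * real n"
      using n1 unfolding n_eq by linarith+
    have "ln (real n) \<le> ln (exp (real K))" using n n1 by (subst ln_le_cancel_iff) auto
    moreover have "ln (exp (real K)) \<le> ln (2 * real n)" using n n1 by (subst ln_le_cancel_iff) auto
    moreover have "ln (2 * real n) = ln 2 + ln (real n)" using n1 by (simp add: ln_mult)
    moreover have "primes_le (exp (real K)) = primes_le (real n)"
      unfolding n_def by (rule primes_le_floor[symmetric]) simp
    ultimately show "\<bar>(\<Sum>p\<in>primes_le (exp (real K)). ln (real p) / real p) - real K\<bar> \<le> C + ln 2"
      using C[of n] n1 by simp
  qed
qed

text \<open>With \<open>l j\<close> the block sum of ln p / p, the term splits into
  \<open>q j - l j / real (Suc j)\<close> and \<open>(l j - 1) / real (Suc j)\<close>. The first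
  part is O(1/j^2); the second is summable by \<open>summable_over_Suc\<close>, as Mertens' first
  theorem bounds the partial sums of \<open>l j - 1\<close>.\<close>

lemma summable_mertens_second:
  "summable (\<lambda>j. (\<Sum>p\<in>prime_class j. 1 / real p) - 1 / real (Suc j))"
proof -
  obtain C where C: "\<And>K. \<bar>(\<Sum>p\<in>primes_le (exp (real K)). ln (real p) / real p) - real K\<bar> \<le> C"
    using mertens_first_exp by blast
  define l where "l = (\<lambda>j. \<Sum>p\<in>prime_class j. ln (real p) / real p)"
  define q where "q = (\<lambda>j. \<Sum>p\<in>prime_class j. 1 / real p)"
  have L: "\<bar>(\<Sum>j<K. l j) - real K\<bar> \<le> C" for K
    using C[of K] unfolding l_def sum_prime_class .
  have l_le: "l j \<le> 2 * C + 1" for j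
    using L[of j] L[of "Suc j"] by simp
  have "\<bar>\<Sum>j<n. l j - 1\<bar> \<le> C" for n using L[of n] by (simp add: sum_subtractf)
  then have s1: "summable (\<lambda>j. (l j - 1) / real (Suc j))" by (rule summable_over_Suc)
  have s2: "summable (\<lambda>j. q j - l j / real (Suc j))"
  \<comment> \<open>The comparison starts at j = 1 because the lower end of block 0 gives no upper
    bound for 1 / ln p.\<close>
  proof (rule summable_comparison_test'[of _ 1])
    show "summable (\<lambda>j. (2 * C + 1) * inverse (real j ^ 2))"
      by (intro summable_mult inverse_power_summable) simp
    fix j :: nat assume j: "j \<ge> 1"
    have eq: "q j - l j / real (Suc j) =
        (\<Sum>p\<in>prime_class j. ln (real p) / real p * (1 / ln (real p) - 1 / real (Suc j)))"
      unfolding q_def l_def sum_divide_distrib sum_subtractf[symmetric]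
    proof (rule sum.cong[OF refl])
      fix p assume "p \<in> prime_class j"
      from prime_classD[OF this] have "real p \<ge> 2" "ln (real p) > 0" using j by auto
      then show "1 / real p - ln (real p) / real p / real (Suc j) =
          ln (real p) / real p * (1 / ln (real p) - 1 / real (Suc j))"
        by (simp add: right_diff_distrib)
    qed
    have b: "0 \<le> ln (real p) / real p * (1 / ln (real p) - 1 / real (Suc j))"
      "ln (real p) / real p * (1 / ln (real p) - 1 / real (Suc j)) \<le>
        ln (real p) / real p * inverse (real j ^ 2)"
      if "p \<in> prime_class j" for p
    proof -
      note p = prime_classD[OF that]
      have pos: "ln (real p) / real p \<ge> 0" using p by simp
      have "1 / ln (real p) \<ge> 1 / real (Suc j)" using p j by (intro divide_left_mono) auto
      then show "0 \<le> ln (real p) / real p * (1 / ln (real p) - 1 / real (Suc j))"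
        using pos by (intro mult_nonneg_nonneg) auto
      have "1 / ln (real p) \<le> 1 / real j" using p j by (intro divide_left_mono) auto
      moreover have "1 / real j - 1 / real (Suc j) = inverse (real j * real (Suc j))"
        using j by (simp add: field_simps)
      moreover have "\<dots> \<le> inverse (real j ^ 2)"
        using j by (intro le_imp_inverse_le) (auto simp: power2_eq_square)
      ultimately show "ln (real p) / real p * (1 / ln (real p) - 1 / real (Suc j)) \<le>
          ln (real p) / real p * inverse (real j ^ 2)"
        by (intro mult_left_mono pos) simp
    qed
    have "q j - l j / real (Suc j) \<le> l j * inverse (real j ^ 2)"
    proof -
      have "q j - l j / real (Suc j) \<le> (\<Sum>p\<in>prime_class j. ln (real p) / real p * inverse (real j ^ 2))"
        unfolding eq by (intro sum_mono b(2))
      then show ?thesis by (simp only: l_def sum_distrib_right)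
    qed
    also have "\<dots> \<le> (2 * C + 1) * inverse (real j ^ 2)"
      by (intro mult_right_mono l_le) simp
    finally show "norm (q j - l j / real (Suc j)) \<le> (2 * C + 1) * inverse (real j ^ 2)"
      using sum_nonneg[of "prime_class j", OF b(1)] unfolding eq by simp
  qed
  have "(\<lambda>j. q j - 1 / real (Suc j)) =
      (\<lambda>j. (q j - l j / real (Suc j)) + (l j - 1) / real (Suc j))"
    by (simp add: diff_divide_distrib)
  with summable_add[OF s2 s1] show ?thesis by (simp add: q_def)
qed

text \<open>Multiplying the \<open>j\<close>-th term by \<open>exp (-\<delta>) ^ Suc j\<close> turns \<open>1 / real (Suc j)\<close> into the series of
  \<open>- ln (1 - exp (-\<delta>))\<close> and makes the prime sum at most \<open>ln\<close> of the zeta function at \<open>1 + \<delta>\<close>; as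
  \<open>\<delta>\<close> tends to \<open>0\<close> the two logarithms cancel.\<close>

lemma mertens_constant_le:
  defines "h \<equiv> (\<lambda>t::real. - ln (1 - t) - t)"
  shows "(\<Sum>j. (\<Sum>p\<in>prime_class j. 1 / real p) - 1 / real (Suc j)) +
    (\<Sum>p\<in>primes_le (exp (real M)). h (1 / real p)) \<le> 0"
proof -
  define q where "q = (\<lambda>j. \<Sum>p\<in>prime_class j. 1 / real p)"
  define a where "a = (\<lambda>j. q j - 1 / real (Suc j))"
  \<comment> \<open>The cut-off \<open>exp (real M)\<close> stays fixed while the range of the
    primes grows, so \<open>H\<close> remains a finite sum and its limit as \<delta> tends to 0 can
    be taken term by term.\<close>
  define H where "H = (\<lambda>\<delta>. \<Sum>p\<in>primes_le (exp (real M)). h (real p powr (-1 - \<delta>)))"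
  have a: "summable a" unfolding a_def q_def by (rule summable_mertens_second)
  have h_nonneg: "h t \<ge> 0" if "t < 1" for t
    using ln_le_minus_one[of "1 - t"] that by (simp add: h_def)
  have le: "exp (-\<delta>) * (\<Sum>j. a j * exp (-\<delta>) ^ j) \<le> ln (1 + 1 / \<delta>) + ln (1 - exp (-\<delta>)) - H \<delta>"
    if \<delta>: "\<delta> > 0" for \<delta> :: real
  proof -
    define z where "z = exp (-\<delta>)"
    have z: "0 < z" "z < 1" using \<delta> by (auto simp: z_def)
    \<comment> \<open>On block j one has ln p <= j + 1, hence z^(j+1) <= p^(-\<delta>). Writing t =
      -ln(1 - t) - h(t) brings in the Euler factors, and h >= 0 allows the terms of h beyond
      \<open>exp (real M)\<close> to be dropped.\<close>
    have bound: "(\<Sum>j<K. q j * z ^ Suc j) \<le> ln (1 + 1 / \<delta>) - H \<delta>" if K: "K \<ge> M" for K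
    proof -
      let ?P = "primes_le (exp (real K))"
      have "(\<Sum>j<K. q j * z ^ Suc j) \<le> (\<Sum>j<K. \<Sum>p\<in>prime_class j. real p powr (-1 - \<delta>))"
        unfolding q_def sum_distrib_right
      proof (intro sum_mono)
        fix j p assume "p \<in> prime_class j"
        note p = prime_classD[OF this]
        have "z ^ Suc j = exp (- \<delta> * real (Suc j))"
          by (simp only: z_def exp_of_nat_mult[symmetric] mult.commute)
        also have "\<dots> \<le> exp (- \<delta> * ln (real p))" using p \<delta> by simp
        also have "\<dots> = real p powr (-\<delta>)" using p by (simp add: powr_def)
        finally have "1 / real p * z ^ Suc j \<le> 1 / real p * real p powr (-\<delta>)"
          by (intro mult_left_mono) auto
        also have "\<dots> = real p powr (-1 - \<delta>)" using p by (simp add: powr_diff powr_minus field_simps)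
        finally show "1 / real p * z ^ Suc j \<le> real p powr (-1 - \<delta>)" .
      qed
      also have "\<dots> = (\<Sum>p\<in>?P. real p powr (-1 - \<delta>))" by (rule sum_prime_class)
      also have "\<dots> = (\<Sum>p\<in>?P. - ln (1 - real p powr (-1 - \<delta>))) - (\<Sum>p\<in>?P. h (real p powr (-1 - \<delta>)))"
        unfolding sum_subtractf[symmetric] by (simp add: h_def)
      finally have "(\<Sum>j<K. q j * z ^ Suc j) \<le>
        (\<Sum>p\<in>?P. - ln (1 - real p powr (-1 - \<delta>))) - (\<Sum>p\<in>?P. h (real p powr (-1 - \<delta>)))" .
      moreover have "(\<Sum>p\<in>?P. - ln (1 - real p powr (-1 - \<delta>))) \<le> ln (1 + 1 / \<delta>)"
        by (rule sum_ln_euler_factor_le[OF \<delta> finite_primes_le]) (auto simp: primes_le_def)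
      moreover have "H \<delta> \<le> (\<Sum>p\<in>?P. h (real p powr (-1 - \<delta>)))"
        unfolding H_def
      proof (intro sum_mono2 h_nonneg)
        show "primes_le (exp (real M)) \<subseteq> ?P"
          using K by (auto simp: primes_le_def intro: order_trans)
        fix p assume "p \<in> ?P - primes_le (exp (real M))"
        then have "real p \<ge> 2" using primes_le_ge_2 by blast
        then have "real p powr (-1 - \<delta>) < real p powr 0" using \<delta> by (intro powr_less_mono) auto
        then show "real p powr (-1 - \<delta>) < 1" using \<open>real p \<ge> 2\<close> by simp
      qed auto
      ultimately show ?thesis by linarith
    qed
    have sm: "summable (\<lambda>j. a j * z ^ j)"
      using powser_inside[of a 1 z] a z by simp
    \<comment> \<open>The inequality for finite K passes to the limit; the subtracted logarithmic
      series has the sum -ln(1 - z).\<close>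
    have "(\<lambda>K. z * (\<Sum>j<K. a j * z ^ j)) \<longlonglongrightarrow> z * (\<Sum>j. a j * z ^ j)"
      by (intro tendsto_intros summable_LIMSEQ sm)
    moreover have "(\<lambda>K. (ln (1 + 1 / \<delta>) - H \<delta>) - (\<Sum>j<K. z ^ Suc j / real (Suc j)))
        \<longlonglongrightarrow> (ln (1 + 1 / \<delta>) - H \<delta>) - (- ln (1 - z))"
      using sums_ln_one_minus[of z] z unfolding sums_def by (intro tendsto_intros) auto
    moreover have "eventually (\<lambda>K. z * (\<Sum>j<K. a j * z ^ j) \<le>
        (ln (1 + 1 / \<delta>) - H \<delta>) - (\<Sum>j<K. z ^ Suc j / real (Suc j))) sequentially"
    proof (rule eventually_sequentiallyI[of M])
      fix K assume "K \<ge> M"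
      have "z * (\<Sum>j<K. a j * z ^ j) = (\<Sum>j<K. q j * z ^ Suc j) - (\<Sum>j<K. z ^ Suc j / real (Suc j))"
        unfolding sum_subtractf[symmetric] sum_distrib_left
        by (intro sum.cong) (auto simp: a_def algebra_simps)
      with bound[OF \<open>K \<ge> M\<close>] show "z * (\<Sum>j<K. a j * z ^ j) \<le>
        (ln (1 + 1 / \<delta>) - H \<delta>) - (\<Sum>j<K. z ^ Suc j / real (Suc j))" by simp
    qed
    ultimately have "z * (\<Sum>j. a j * z ^ j) \<le> (ln (1 + 1 / \<delta>) - H \<delta>) - (- ln (1 - z))"
      using tendsto_le[OF sequentially_bot] by blast
    then show ?thesis by (simp add: z_def)
  qed
  have exp_lim: "filterlim (\<lambda>\<delta>::real. exp (-\<delta>)) (at_left 1) (at_right 0)" by real_asymp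
  have l1: "((\<lambda>\<delta>. exp (-\<delta>) * (\<Sum>j. a j * exp (-\<delta>) ^ j)) \<longlongrightarrow> exp (- 0) * suminf a) (at_right 0)"
    by (intro tendsto_intros filterlim_compose[OF abel_limit[OF a] exp_lim])
  \<comment> \<open>The product (1 + 1/\<delta>)(1 - exp(-\<delta>)) tends to 1, so no constant is
    left over.\<close>
  have "((\<lambda>\<delta>::real. ln (1 + 1 / \<delta>) + ln (1 - exp (-\<delta>))) \<longlongrightarrow> 0) (at_right 0)" by real_asymp
  moreover have "(H \<longlongrightarrow> (\<Sum>p\<in>primes_le (exp (real M)). h (real p powr (-1 - 0)))) (at_right 0)"
    unfolding H_def
  proof (rule tendsto_sum)
    fix p assume "p \<in> primes_le (exp (real M))"
    then have p: "real p \<ge> 2" by (rule primes_le_ge_2)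
    then have "real p powr (-1 - 0) \<noteq> 1" by (simp add: powr_minus field_simps)
    then show "((\<lambda>\<delta>. h (real p powr (-1 - \<delta>))) \<longlongrightarrow> h (real p powr (-1 - 0))) (at_right 0)"
      unfolding h_def using p by (intro tendsto_intros) auto
  qed
  ultimately have l2: "((\<lambda>\<delta>. ln (1 + 1 / \<delta>) + ln (1 - exp (-\<delta>)) - H \<delta>) \<longlongrightarrow>
      0 - (\<Sum>p\<in>primes_le (exp (real M)). h (real p powr (-1 - 0)))) (at_right 0)"
    by (intro tendsto_intros)
  have "eventually (\<lambda>\<delta>. exp (-\<delta>) * (\<Sum>j. a j * exp (-\<delta>) ^ j) \<le>
      ln (1 + 1 / \<delta>) + ln (1 - exp (-\<delta>)) - H \<delta>) (at_right 0)"
    using le by (auto simp: eventually_at_filter)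
  from tendsto_le[OF trivial_limit_at_right_real l2 l1 this]
  have "suminf a \<le> - (\<Sum>p\<in>primes_le (exp (real M)). h (real p powr (-1 - 0)))" by simp
  also have "(\<Sum>p\<in>primes_le (exp (real M)). h (real p powr (-1 - 0))) =
      (\<Sum>p\<in>primes_le (exp (real M)). h (1 / real p))"
    by (intro sum.cong refl arg_cong[where f = h])
      (auto dest!: primes_le_ge_2 simp: powr_minus field_simps)
  finally show ?thesis by (simp add: a_def q_def)
qed

text \<open>Minus the logarithm of the product is the sum of 1/p plus the sum of h(1/p). The former
  equals \<open>harm M\<close> plus a partial sum of the series in
  \<open>summable_mertens_second\<close>; by \<open>mertens_constant_le\<close> the latter is at
  most minus the full sum of that series. The two cancel up to a tail, and
  \<open>harm M - ln (real M)\<close> supplies gamma.\<close>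

theorem mertens_third_lower:
  "\<exists>e. e \<longlonglongrightarrow> 0 \<and> (\<forall>M>0. (\<Prod>p\<in>primes_le (exp (real M)). 1 - 1 / real p)
      \<ge> exp (- euler_mascheroni - e M) / real M)"
proof -
  define a where "a = (\<lambda>j. (\<Sum>p\<in>prime_class j. 1 / real p) - 1 / real (Suc j))"
  define e where "e = (\<lambda>M. ((\<Sum>j<M. a j) - suminf a) + (harm M - ln (real M) - euler_mascheroni))"
  have "(\<lambda>M. \<Sum>j<M. a j) \<longlonglongrightarrow> suminf a"
    unfolding a_def by (rule summable_LIMSEQ[OF summable_mertens_second])
  then have "e \<longlonglongrightarrow> (suminf a - suminf a) + (euler_mascheroni - euler_mascheroni)"
    unfolding e_def by (intro tendsto_intros euler_mascheroni_LIMSEQ)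
  moreover have "(\<Prod>p\<in>primes_le (exp (real M)). 1 - 1 / real p)
      \<ge> exp (- euler_mascheroni - e M) / real M" if M: "M > 0" for M
  proof -
    let ?P = "primes_le (exp (real M))"
    have pos: "1 - 1 / real p > 0" if "p \<in> ?P" for p using primes_le_ge_2[OF that] by simp
    have "(\<Sum>p\<in>?P. - ln (1 - 1 / real p)) =
        (\<Sum>p\<in>?P. 1 / real p) + (\<Sum>p\<in>?P. - ln (1 - 1 / real p) - 1 / real p)"
      unfolding sum.distrib[symmetric] by simp
    also have "(\<Sum>p\<in>?P. 1 / real p) = (\<Sum>j<M. a j) + harm M"
      unfolding sum_prime_class[symmetric] a_def
      by (simp add: sum_subtractf harm_altdef inverse_eq_divide)
    also have "(\<Sum>p\<in>?P. - ln (1 - 1 / real p) - 1 / real p) \<le> - suminf a"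
      using mertens_constant_le[of M] by (simp add: a_def)
    finally have "(\<Sum>p\<in>?P. - ln (1 - 1 / real p)) \<le> euler_mascheroni + e M + ln (real M)"
      by (simp add: e_def)
    then have "- euler_mascheroni - e M - ln (real M) \<le> (\<Sum>p\<in>?P. ln (1 - 1 / real p))"
      by (simp add: sum_negf)
    then have "exp (- euler_mascheroni - e M - ln (real M)) \<le> exp (\<Sum>p\<in>?P. ln (1 - 1 / real p))"
      by simp
    also have "\<dots> = (\<Prod>p\<in>?P. 1 - 1 / real p)"
      unfolding exp_sum[OF finite_primes_le] using pos by (intro prod.cong) auto
    finally show ?thesis using M by (simp add: exp_diff)
  qed
  ultimately show ?thesis by (intro exI[of _ e]) auto
qed

section \<open>Brun's pure sieve\<close>

lemma sum_subsets_by_card: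
  fixes f :: "nat \<Rightarrow> real"
  assumes "finite S"
  shows "(\<Sum>D | D \<subseteq> S \<and> card D \<le> m. f (card D)) = (\<Sum>j\<le>m. real (card S choose j) * f j)"
proof -
  have "(\<Sum>D | D \<subseteq> S \<and> card D \<le> m. f (card D)) =
      (\<Sum>j\<le>m. \<Sum>D\<in>{D \<in> {D. D \<subseteq> S \<and> card D \<le> m}. card D = j}. f (card D))"
    by (rule sum.group[symmetric]) (use assms in auto)
  also have "\<dots> = (\<Sum>j\<le>m. \<Sum>D | D \<subseteq> S \<and> card D = j. f j)"
    by (intro sum.cong) auto
  also have "\<dots> = (\<Sum>j\<le>m. real (card S choose j) * f j)"
    by (simp add: n_subsets[OF assms])
  finally show ?thesis .
qed

text \<open>Bonferroni's inequality: for nonempty \<open>S\<close> the alternating sum of binomial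
  coefficients up to m equals (-1)^m times the coefficient of |S| - 1 over m, which is nonpositive
  for odd m.\<close>

lemma truncated_inclusion_exclusion:
  assumes "finite S" "odd m"
  shows "(\<Sum>D | D \<subseteq> S \<and> card D \<le> m. (-1) ^ card D) \<le> (if S = {} then 1 else 0 :: real)"
proof (cases "S = {}")
  case True
  then have "{D. D \<subseteq> S \<and> card D \<le> m} = {{}}" by auto
  then show ?thesis using True by simp
next
  case False
  then have c: "card S > 0" using assms by (simp add: card_gt_0_iff)
  have "(\<Sum>D | D \<subseteq> S \<and> card D \<le> m. (-1) ^ card D) =
      (\<Sum>j\<le>m. (real (card S) gchoose j) * (-1) ^ j)"
    by (simp add: sum_subsets_by_card[OF assms(1), of "\<lambda>j. (-1) ^ j" m] binomial_gbinomial)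
  also have "\<dots> = - (real (card S) - 1 gchoose m)"
    using assms(2) by (simp add: gbinomial_sum_lower_neg)
  also have "real (card S) - 1 = real (card S - 1)" using c by simp
  also have "- (real (card S - 1) gchoose m) \<le> 0"
    by (simp flip: binomial_gbinomial)
  finally show ?thesis using False by simp
qed

text \<open>Counts the rounding errors of the sieve. Termwise comparison with the binomial expansion
  works because C(s, j) <= s^j <= C(m, j) s^j for j <= m.\<close>

lemma card_subsets_le_power:
  assumes "finite S"
  shows "real (card {D. D \<subseteq> S \<and> card D \<le> m}) \<le> (1 + real (card S)) ^ m"
proof -
  have "real (card {D. D \<subseteq> S \<and> card D \<le> m}) = (\<Sum>j\<le>m. real (card S choose j))"
    using sum_subsets_by_card[OF assms, of "\<lambda>_. 1" m] by simp
  also have "\<dots> \<le> (\<Sum>j\<le>m. real (m choose j) * real (card S) ^ j)"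
  proof (rule sum_mono)
    fix j assume j: "j \<in> {..m}"
    have "card S choose j \<le> card S ^ j"
      using binomial_le_pow[of j "card S"] binomial_eq_0[of "card S" j]
      by (metis not_le zero_le)
    also have "\<dots> \<le> (m choose j) * card S ^ j" using j mult_le_mono1[of 1 "m choose j" "card S ^ j"] zero_less_binomial[of j m] by (simp add: Suc_leI del: zero_less_binomial_iff)
    finally show "real (card S choose j) \<le> real (m choose j) * real (card S) ^ j"
      by (metis of_nat_le_iff of_nat_mult of_nat_power)
  qed
  also have "\<dots> = (1 + real (card S)) ^ m"
    by (subst add.commute, subst binomial_ring) simp
  finally show ?thesis .
qed

lemma card_multiples:
  fixes d N :: nat assumes "d > 0"
  shows "card {n\<in>{1..N}. d dvd n} = N div d"
proof -
  have "{n\<in>{1..N}. d dvd n} = (\<lambda>k. d * k) ` {1..N div d}"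
    using assms by (auto simp: less_eq_div_iff_mult_less_eq mult.commute elim!: dvdE)
  also have "card \<dots> = N div d"
    using assms by (subst card_image) (auto simp: inj_on_def)
  finally show ?thesis .
qed

text \<open>After exchanging the sums, each n contributes the truncated alternating sum over subsets
  of the primes in \<open>P\<close> that divide n, which is at most the indicator that there are
  none.\<close>

lemma card_rough_ge:
  fixes P :: "nat set"
  assumes fin: "finite P" and prime: "\<And>p. p \<in> P \<Longrightarrow> prime p" and m: "odd m"
  shows "(\<Sum>D | D \<subseteq> P \<and> card D \<le> m. (-1) ^ card D * real (N div \<Prod>D))
           \<le> real (card {n\<in>{1..N}. \<forall>p\<in>P. \<not> p dvd n})"
proof -
  let ?\<D> = "{D. D \<subseteq> P \<and> card D \<le> m}"
  have fin': "finite ?\<D>" using fin by simp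
  have "(\<Sum>D\<in>?\<D>. (-1) ^ card D * real (N div \<Prod>D)) =
      (\<Sum>D\<in>?\<D>. \<Sum>n=1..N. if \<Prod>D dvd n then (-1) ^ card D else 0)"
  proof (rule sum.cong[OF refl])
    fix D assume D: "D \<in> ?\<D>"
    then have "\<Prod>D > 0" using prime by (intro prod_pos) (blast intro: prime_gt_0_nat)
    then have "real (N div \<Prod>D) = (\<Sum>n\<in>{n\<in>{1..N}. \<Prod>D dvd n}. 1)"
      by (simp only: card_multiples[symmetric]) simp
    also have "\<dots> = (\<Sum>n=1..N. if \<Prod>D dvd n then 1 else 0)"
      by (simp only: sum.inter_filter[OF finite_atLeastAtMost])
    finally show "(-1) ^ card D * real (N div \<Prod>D) =
        (\<Sum>n=1..N. if \<Prod>D dvd n then (-1) ^ card D else 0)"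
      by (simp add: sum_distrib_left if_distrib cong: if_cong)
  qed
  also have "\<dots> = (\<Sum>n=1..N. \<Sum>D\<in>?\<D>. if \<Prod>D dvd n then (-1) ^ card D else 0)"
    by (rule sum.swap)
  also have "\<dots> \<le> (\<Sum>n=1..N. if \<forall>p\<in>P. \<not> p dvd n then 1 else 0)"
  proof (rule sum_mono)
    fix n
    define S where "S = {p\<in>P. p dvd n}"
    have "(\<Sum>D\<in>?\<D>. if \<Prod>D dvd n then (-1) ^ card D else 0) =
        (\<Sum>D\<in>{D\<in>?\<D>. \<Prod>D dvd n}. (-1) ^ card D :: real)"
      using fin' by (simp only: sum.inter_filter)
    also have "{D\<in>?\<D>. \<Prod>D dvd n} = {D. D \<subseteq> S \<and> card D \<le> m}"
    proof -
      have "\<Prod>D dvd n \<longleftrightarrow> (\<forall>p\<in>D. p dvd n)" if "D \<subseteq> P" for D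
        by (rule prod_primes_dvd_iff) (use that prime finite_subset[OF _ fin] in auto)
      then show ?thesis unfolding S_def by auto
    qed
    also have "(\<Sum>D\<in>\<dots>. (-1) ^ card D :: real) \<le> (if S = {} then 1 else 0)"
      by (rule truncated_inclusion_exclusion) (use fin m in \<open>auto simp: S_def\<close>)
    also have "\<dots> = (if \<forall>p\<in>P. \<not> p dvd n then 1 else 0)" by (auto simp: S_def)
    finally show "(\<Sum>D\<in>?\<D>. if \<Prod>D dvd n then (-1) ^ card D else 0) \<le>
      (if \<forall>p\<in>P. \<not> p dvd n then 1 else 0 :: real)" .
  qed
  also have "\<dots> = real (card {n\<in>{1..N}. \<forall>p\<in>P. \<not> p dvd n})"
    by (simp flip: sum.inter_filter)
  finally show ?thesis .
qed

text \<open>The truncated sum of N/d is compared with the full product over \<open>P\<close>. The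
  two subtracted terms pay for the sets of more than m primes and for one rounding error per
  remaining set.\<close>

theorem brun_pure_sieve:
  fixes P :: "nat set"
  assumes fin: "finite P" and prime: "\<And>p. p \<in> P \<Longrightarrow> prime p" and m: "odd m"
  shows "real N * ((\<Prod>p\<in>P. 1 - 1 / real p) - (\<Prod>p\<in>P. 1 + 2 / real p) / 2 ^ Suc m)
           - (1 + real (card P)) ^ m
         \<le> real (card {n\<in>{1..N}. \<forall>p\<in>P. \<not> p dvd n})"
proof -
  let ?\<D> = "{D. D \<subseteq> P \<and> card D \<le> m}" and ?\<E> = "{D. D \<subseteq> P \<and> card D > m}"
  define f where "f = (\<lambda>D. (\<Prod>p\<in>D. 1 / real p))"
  have f_nonneg: "f D \<ge> 0" for D by (auto simp: f_def intro!: prod_nonneg)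
  have fin': "finite ?\<D>" "finite ?\<E>" using fin by auto
  have split: "Pow P = ?\<D> \<union> ?\<E>" by auto
  have "(\<Prod>p\<in>P. 1 - 1 / real p) = (\<Sum>D\<in>Pow P. (-1) ^ card D * f D)"
    using prod_diff_conv_sum[OF fin, of "\<lambda>_. 1" "\<lambda>p. 1 / real p"] by (simp add: f_def)
  also have "\<dots> = (\<Sum>D\<in>?\<D>. (-1) ^ card D * f D) + (\<Sum>D\<in>?\<E>. (-1) ^ card D * f D)"
    unfolding split by (rule sum.union_disjoint) (use fin' in auto)
  \<comment> \<open>Rankin's trick: on \<open>?\<E>\<close> the weight \<open>2 ^ card D / 2 ^ Suc m\<close> is at least \<open>1\<close>.\<close>
  also have "(\<Sum>D\<in>?\<E>. (-1) ^ card D * f D) \<le> (\<Sum>D\<in>?\<E>. (2 ^ card D * f D) / 2 ^ Suc m)"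
  proof (rule sum_mono)
    fix D assume D: "D \<in> ?\<E>"
    have "(-1) ^ card D \<le> (1::real)" by (cases "even (card D)") auto
    also have "(1::real) \<le> 2 ^ card D / 2 ^ Suc m"
      using D power_increasing[of "Suc m" "card D" "2::real"] by (simp add: field_simps)
    finally show "(-1) ^ card D * f D \<le> (2 ^ card D * f D) / 2 ^ Suc m"
      using mult_right_mono[OF _ f_nonneg[of D]] by fastforce
  qed
  also have "\<dots> \<le> (\<Sum>D\<in>Pow P. (2 ^ card D * f D) / 2 ^ Suc m)"
    by (rule sum_mono2) (use fin f_nonneg in auto)
  also have "\<dots> = (\<Prod>p\<in>P. 1 + 2 / real p) / 2 ^ Suc m"
  proof -
    have "(\<Prod>p\<in>P. 1 + 2 / real p) = (\<Prod>p\<in>P. 2 / real p + 1)" by (simp add: add.commute)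
    also have "\<dots> = (\<Sum>D\<in>Pow P. (\<Prod>p\<in>D. 2 / real p))"
      by (subst prod_add[OF fin]) simp
    also have "\<dots> = (\<Sum>D\<in>Pow P. 2 ^ card D * f D)"
      by (simp add: f_def prod_dividef)
    finally show ?thesis by (simp add: sum_divide_distrib)
  qed
  finally have main: "(\<Prod>p\<in>P. 1 - 1 / real p) - (\<Prod>p\<in>P. 1 + 2 / real p) / 2 ^ Suc m
      \<le> (\<Sum>D\<in>?\<D>. (-1) ^ card D * f D)" by simp
  have "real N * (\<Sum>D\<in>?\<D>. (-1) ^ card D * f D) - (1 + real (card P)) ^ m \<le>
      real N * (\<Sum>D\<in>?\<D>. (-1) ^ card D * f D) - real (card ?\<D>)"
    using card_subsets_le_power[OF fin, of m] by simp
  also have "\<dots> = (\<Sum>D\<in>?\<D>. (-1) ^ card D * (real N * f D) - 1)"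
    by (simp add: sum_subtractf sum_distrib_left mult_ac)
  \<comment> \<open>Rounding down lowers the positive terms by at most 1 and can only raise the
    negative ones.\<close>
  also have "\<dots> \<le> (\<Sum>D\<in>?\<D>. (-1) ^ card D * real (N div \<Prod>D))"
  proof (rule sum_mono)
    fix D assume D: "D \<in> ?\<D>"
    have "real N * f D = real N / real (\<Prod>D)"
      by (simp add: f_def prod_dividef)
    moreover have "real (N div \<Prod>D) \<le> real N / real (\<Prod>D)" by (rule of_nat_div_le_of_nat)
    moreover have "real N / real (\<Prod>D) - 1 \<le> real (N div \<Prod>D)"
      using real_of_int_floor_gt_diff_one[of "real N / real (\<Prod>D)"]
      unfolding floor_divide_of_nat_eq by simp
    ultimately show "(-1) ^ card D * (real N * f D) - 1 \<le> (-1) ^ card D * real (N div \<Prod>D)"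
      by (cases "even (card D)") auto
  qed
  also have "\<dots> \<le> real (card {n\<in>{1..N}. \<forall>p\<in>P. \<not> p dvd n})"
    by (rule card_rough_ge[OF fin prime m])
  finally show ?thesis using mult_left_mono[OF main, of "real N"] by simp
qed

section \<open>Tilings of score zero and divisors of squares\<close>

text \<open>The witness k is the number of tiles of a tiling of score zero.\<close>

lemma mondrian_M_eq_0_imp_card_divisors:
  assumes n: "n \<ge> 3" and M: "mondrian_M n = 0"
  obtains k where "k \<ge> 2" "k dvd n ^ 2" "k \<le> card {d. d dvd n ^ 2}"
proof -
  obtain T where T: "mondrian_tiling n T" and sc: "tiling_score T = 0"
    using mondrian_M_attained(1)[OF n] M by (auto simp: mondrian_scores_def)
  have div: "T division_of cbox (0, 0) (real n, real n)" and card: "card T \<ge> 2"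
    and rect: "\<forall>R\<in>T. \<exists>a b. rect_with_sides R a b"
    and incong: "\<And>R S. R \<in> T \<Longrightarrow> S \<in> T \<Longrightarrow> R \<noteq> S \<Longrightarrow> \<not> congruent_rects R S"
    using T by (auto simp: mondrian_tiling_def)
  have fin: "finite T" using div by blast
  obtain f g where fg: "\<And>R. R \<in> T \<Longrightarrow> rect_with_sides R (f R) (g R)"
    using rect by metis
  define c where "c = Max (measure lborel ` T)"
  have c_eq: "measure lborel R = c" if "R \<in> T" for R
  proof -
    have "measure lborel R \<le> c" "Min (measure lborel ` T) \<le> measure lborel R"
      using that fin by (auto simp: c_def)
    then show ?thesis using sc by (simp add: c_def tiling_score_def)
  qed
  have "real n * real n = measure lborel (cbox (0::real, 0::real) (real n, real n))"
    by (subst content_Pair) auto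
  also have "\<dots> = (\<Sum>R\<in>T. measure lborel R)"
    using additive_content_division[OF div] by simp
  also have "\<dots> = real (card T) * c" using c_eq by simp
  finally have area: "real n * real n = real (card T) * c" .
  obtain R0 where R0: "R0 \<in> T" using card by fastforce
  define A where "A = f R0 * g R0"
  have "c = real A"
    unfolding A_def using content_rect_with_sides[OF fg[OF R0]] c_eq[OF R0] by simp
  with area have nA: "n ^ 2 = card T * A"
    by (metis of_nat_eq_iff of_nat_mult power2_eq_square)
  have prod: "f R * g R = A" if "R \<in> T" for R
    using content_rect_with_sides[OF fg[OF that]] c_eq[OF that] \<open>c = real A\<close> of_nat_eq_iff by metis
  \<comment> \<open>Equal widths and equal areas force equal heights, so distinct tiles of the same
    width would be congruent.\<close>
  have "inj_on f T"
  proof (rule inj_onI)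
    fix R S assume RS: "R \<in> T" "S \<in> T" "f R = f S"
    have "f R > 0" using fg[OF RS(1)] by (auto simp: rect_with_sides_def)
    then have "g R = g S" using prod[OF RS(1)] prod[OF RS(2)] RS(3) by auto
    then show "R = S"
      using incong[OF RS(1,2)] fg[OF RS(1)] fg[OF RS(2)] RS(3)
      by (auto simp: congruent_rects_def)
  qed
  moreover have "f ` T \<subseteq> {d. d dvd n ^ 2}"
    unfolding nA using prod by (auto intro!: dvd_mult) (metis dvd_triv_left)
  moreover have "finite {d. d dvd n ^ 2}" using n by (intro finite_divisors_nat) auto
  ultimately have "card T \<le> card {d. d dvd n ^ 2}" by (metis card_inj_on_le)
  with that[of "card T"] card nA show ?thesis by simp
qed

section \<open>The average number of divisors of a square\<close>

lemma dvd_square_imp_factorization: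
  fixes d n :: nat
  assumes n: "n > 0" and d: "d dvd n ^ 2"
  obtains g r s where "g * r * s = n" "g * r ^ 2 = d"
proof -
  \<comment> \<open>Dividing d and its cofactor e by their gcd leaves coprime numbers u and v whose
    product is a square; hence both are squares.\<close>
  obtain e where e: "n ^ 2 = d * e" using d by blast
  define g where "g = gcd d e"
  obtain u v where uv: "d = g * u" "e = g * v" "coprime u v"
    unfolding g_def using n e by (metis gcd_coprime_exists gcd_eq_0_iff mult.commute mult_zero_left
        power_not_zero zero_less_iff_neq_zero)
  have g2: "n ^ 2 = g ^ 2 * (u * v)" using e uv by (simp add: power2_eq_square)
  then have "g ^ 2 dvd n ^ 2" by simp
  then have "g dvd n" by simp
  then obtain t where t: "n = g * t" by blast
  have "g > 0" using n t by simp
  then have "u * v = t ^ 2" using g2 t by (simp add: power_mult_distrib)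
  then have "is_nth_power 2 (u * v)" by auto
  then have "is_nth_power 2 u" "is_nth_power 2 v"
    using is_nth_power_mult_coprime_nat_iff[OF uv(3), of 2] by auto
  then obtain r s where rs: "u = r ^ 2" "v = s ^ 2" by (auto elim!: is_nth_powerE)
  have "t ^ 2 = (r * s) ^ 2" using \<open>u * v = t ^ 2\<close> rs by (simp add: power_mult_distrib)
  then have "t = r * s" by (simp add: power2_eq_iff_nonneg)
  then show ?thesis using that[of g r s] t uv rs by (simp add: mult_ac)
qed

lemma card_nat_mult_le:
  fixes m N :: nat assumes "m > 0"
  shows "real (card {s \<in> {1..N}. m * s \<le> N}) \<le> real N / real m"
proof -
  have "{s \<in> {1..N}. m * s \<le> N} \<subseteq> {1..N div m}"
    using assms by (auto simp: less_eq_div_iff_mult_less_eq mult.commute)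
  then have "card {s \<in> {1..N}. m * s \<le> N} \<le> N div m"
    using card_mono[of "{1..N div m}"] by force
  also have "real (N div m) \<le> real N / real m" by (rule of_nat_div_le_of_nat)
  finally show ?thesis by simp
qed

text \<open>By \<open>dvd_square_imp_factorization\<close> the triples (g, r, s) with g r s <= N
  cover all pairs (n, d). For given g and r there are at most N/(g r) choices of s, and summing this
  yields the square of the harmonic number.\<close>

lemma sum_card_divisors_square_le:
  "(\<Sum>n=1..N. real (card {d. d dvd n ^ 2})) \<le> real N * harm N ^ 2"
proof -
  define X where "X = (SIGMA g:{1..N}. SIGMA r:{1..N}. {s\<in>{1..N}. (g * r) * s \<le> N})"
  have "(SIGMA n:{1..N}. {d. d dvd n ^ 2}) \<subseteq> (\<lambda>(g, r, s). (g * r * s, g * r ^ 2)) ` X"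
  proof safe
    fix n d assume n: "n \<in> {1..N}" and "d dvd n ^ 2"
    then obtain g r s where grs: "g * r * s = n" "g * r ^ 2 = d"
      using dvd_square_imp_factorization[of n d] by auto
    have "g > 0" "r > 0" "s > 0" using grs n by (auto intro!: Nat.gr0I)
    then have "g \<le> n" "r \<le> n" "s \<le> n"
      unfolding grs(1)[symmetric] by (auto simp: Suc_le_eq)
    then have "(g, r, s) \<in> X" using grs n \<open>g > 0\<close> \<open>r > 0\<close> \<open>s > 0\<close> by (auto simp: X_def)
    then show "(n, d) \<in> (\<lambda>(g, r, s). (g * r * s, g * r ^ 2)) ` X"
      using grs by force
  qed
  moreover have finX: "finite X" unfolding X_def by auto
  ultimately have "card (SIGMA n:{1..N}. {d. d dvd n ^ 2}) \<le> card X"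
    by (meson card_image_le card_mono finite_imageI order_trans)
  moreover have "card (SIGMA n:{1..N}. {d. d dvd n ^ 2}) = (\<Sum>n=1..N. card {d. d dvd n ^ 2})"
    by (subst card_SigmaI) auto
  moreover have "card X = (\<Sum>g=1..N. \<Sum>r=1..N. card {s\<in>{1..N}. (g * r) * s \<le> N})"
    unfolding X_def by (subst card_SigmaI; (intro ballI finite_SigmaI)?)
      (auto intro!: sum.cong simp: card_SigmaI)
  ultimately have "(\<Sum>n=1..N. real (card {d. d dvd n ^ 2})) \<le>
      (\<Sum>g=1..N. \<Sum>r=1..N. real (card {s\<in>{1..N}. (g * r) * s \<le> N}))"
    by (metis (mono_tags, lifting) of_nat_le_iff of_nat_sum sum.cong)
  also have "\<dots> \<le> (\<Sum>g=1..N. \<Sum>r=1..N. real N / real (g * r))"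
    by (intro sum_mono card_nat_mult_le) auto
  also have "\<dots> = real N * harm N ^ 2"
    by (simp add: harm_def power2_eq_square sum_product sum_distrib_left field_simps)
  finally show ?thesis .
qed

lemma harm_le_1_plus_ln:
  assumes "N > 0" shows "harm N \<le> 1 + ln (real N)"
  using euler_mascheroni_sequence_decreasing[of 1 N] assms by (simp add: harm_def)

text \<open>Markov's inequality applied to the mean value bound.\<close>

lemma card_many_divisors_le:
  assumes N: "N > 0" and y: "y > 0"
  shows "real (card {n\<in>{1..N}. real (card {d. d dvd n ^ 2}) \<ge> y}) \<le> real N * (1 + ln (real N)) ^ 2 / y"
proof -
  let ?B = "{n\<in>{1..N}. real (card {d. d dvd n ^ 2}) \<ge> y}"
  have "real (card ?B) * y = (\<Sum>n\<in>?B. y)" by simp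
  also have "\<dots> \<le> (\<Sum>n\<in>?B. real (card {d. d dvd n ^ 2}))" by (intro sum_mono) auto
  also have "\<dots> \<le> (\<Sum>n=1..N. real (card {d. d dvd n ^ 2}))" by (intro sum_mono2) auto
  also have "\<dots> \<le> real N * harm N ^ 2" by (rule sum_card_divisors_square_le)
  also have "\<dots> \<le> real N * (1 + ln (real N)) ^ 2"
    by (intro mult_left_mono power_mono harm_le_1_plus_ln harm_nonneg) (use N in auto)
  finally show ?thesis using y by (simp add: field_simps)
qed

lemma mondrian_M_eq_0_imp_prime:
  assumes n: "n \<ge> 3" and M: "mondrian_M n = 0"
  obtains p where "prime p" "p dvd n" "p \<le> card {d. d dvd n ^ 2}"
proof -
  obtain k where k: "k \<ge> 2" "k dvd n ^ 2" "k \<le> card {d. d dvd n ^ 2}"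
    using mondrian_M_eq_0_imp_card_divisors[OF n M] .
  obtain p where p: "prime p" "p dvd k" using k(1) prime_factor_nat[of k] by auto
  have "p dvd n" using p k(2) by (meson dvd_trans prime_dvd_power)
  moreover have "p \<le> k" using p(2) k(1) by (intro dvd_imp_le) auto
  ultimately show ?thesis using that p(1) k(3) by auto
qed

section \<open>Counting the sizes with positive score\<close>

text \<open>Lets the Mertens bound also control the Rankin term of the sieve; with t = 1/p it comes
  down to (1 + 2t)(1 - t)^2 <= 1.\<close>

lemma prod_one_plus_two_over_le:
  "(\<Prod>p\<in>primes_le x. 1 + 2 / real p) \<le> 1 / (\<Prod>p\<in>primes_le x. 1 - 1 / real p) ^ 2"
proof -
  have "(\<Prod>p\<in>primes_le x. 1 + 2 / real p) \<le> (\<Prod>p\<in>primes_le x. 1 / (1 - 1 / real p) ^ 2)"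
  proof (rule prod_mono, intro conjI)
    fix p assume "p \<in> primes_le x"
    then have p: "real p \<ge> 2" by (rule primes_le_ge_2)
    define t where "t = 1 / real p"
    have t: "0 \<le> t" "t \<le> 1 / 2" using p by (auto simp: t_def field_simps)
    have "(1 + 2 * t) * (1 - t) ^ 2 = 1 - t ^ 2 * (3 - 2 * t)"
      by (simp add: power2_eq_square algebra_simps)
    also have "\<dots> \<le> 1" using t by simp
    finally have "1 + 2 * t \<le> 1 / (1 - t) ^ 2" using t by (simp add: pos_le_divide_eq)
    then show "1 + 2 / real p \<le> 1 / (1 - 1 / real p) ^ 2" by (simp add: t_def)
  qed simp
  then show ?thesis by (simp add: prod_dividef prod_power_distrib)
qed

lemma card_primes_le: "x \<ge> 0 \<Longrightarrow> real (card (primes_le x)) \<le> x"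
proof -
  assume x: "x \<ge> 0"
  have "primes_le x \<subseteq> {1..nat \<lfloor>x\<rfloor>}"
    by (auto simp: primes_le_def le_nat_floor Suc_le_eq prime_gt_0_nat)
  then have "card (primes_le x) \<le> nat \<lfloor>x\<rfloor>" using card_mono[of "{1..nat \<lfloor>x\<rfloor>}"] by force
  then show ?thesis using x by linarith
qed

text \<open>The sieve is run up to exp K at truncation level 2K + 1. At this level the factor 2^(2K
  + 2) outweighs K^2, while the rounding errors number only exp(O(K^2)).\<close>

lemma card_mondrian_M_ne_0_ge:
  fixes x g :: real and K :: nat
  assumes x: "x \<ge> 1" and K: "K > 0" and g: "g > 0"
    and mertens: "(\<Prod>p\<in>primes_le (exp (real K)). 1 - 1 / real p) \<ge> g / real K"
  shows "real (card {n. real n \<le> x \<and> n \<ge> 3 \<and> mondrian_M n \<noteq> 0}) \<ge>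
    real (nat \<lfloor>x\<rfloor>) * (g / real K - real K ^ 2 / (g ^ 2 * 2 ^ (2 * K + 2)))
      - exp ((real K + 1) * (2 * real K + 1)) - 2 - x * (1 + ln x) ^ 2 / exp (real K)"
proof -
  define N where "N = nat \<lfloor>x\<rfloor>"
  have N: "N > 0" "real N \<le> x" using x by (auto simp: N_def le_nat_iff le_floor_iff)
  have N_iff: "n \<le> N \<longleftrightarrow> real n \<le> x" for n
    using x by (simp add: N_def le_nat_iff le_floor_iff)
  define P where "P = primes_le (exp (real K))"
  define C where "C = {n. real n \<le> x \<and> n \<ge> 3 \<and> mondrian_M n \<noteq> 0}"
  define R where "R = {n\<in>{1..N}. \<forall>p\<in>P. \<not> p dvd n}"
  define B where "B = {n\<in>{1..N}. real (card {d. d dvd n ^ 2}) \<ge> exp (real K)}"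
  have "finite C" by (rule finite_subset[of _ "{..N}"]) (auto simp: C_def N_iff)
  \<comment> \<open>If n >= 3 has score 0, it has a prime factor p not exceeding the number of
    divisors of n^2. A sifted n only has prime factors above exp K, so n lies in
    \<open>B\<close>.\<close>
  have "R \<subseteq> C \<union> {1, 2} \<union> B"
  proof
    fix n assume n: "n \<in> R"
    show "n \<in> C \<union> {1, 2} \<union> B"
    proof (cases "n \<ge> 3 \<and> mondrian_M n = 0")
      case True
      then obtain p where p: "prime p" "p dvd n" "p \<le> card {d. d dvd n ^ 2}"
        using mondrian_M_eq_0_imp_prime by blast
      then have "p \<notin> P" using n by (auto simp: R_def)
      then have "exp (real K) < real p" using p(1) by (auto simp: P_def primes_le_def)
      then show ?thesis using p(3) n by (auto simp: B_def R_def)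
    qed (use n in \<open>auto simp: C_def R_def N_iff\<close>)
  qed
  then have "card R \<le> card (C \<union> {1, 2} \<union> B)"
    by (rule card_mono[rotated]) (use \<open>finite C\<close> in \<open>auto simp: B_def\<close>)
  also have "\<dots> \<le> card C + card {1::nat, 2} + card B"
    by (meson add_le_mono card_Un_le le_refl order_trans)
  finally have card_le: "real (card R) \<le> real (card C) + 2 + real (card B)" by simp
  have "real (card B) \<le> real N * (1 + ln (real N)) ^ 2 / exp (real K)"
    unfolding B_def by (rule card_many_divisors_le) (use N in auto)
  also have "\<dots> \<le> x * (1 + ln x) ^ 2 / exp (real K)"
    using N x by (intro divide_right_mono mult_mono power_mono add_left_mono) auto
  finally have B_le: "real (card B) \<le> x * (1 + ln x) ^ 2 / exp (real K)" .
  define V where "V = (\<Prod>p\<in>P. 1 - 1 / real p)"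
  have V: "V \<ge> g / real K" using mertens by (simp add: V_def P_def)
  have gK: "g / real K > 0" using g K by simp
  have "(\<Prod>p\<in>P. 1 + 2 / real p) \<le> 1 / V ^ 2"
    unfolding V_def P_def by (rule prod_one_plus_two_over_le)
  also have "\<dots> \<le> 1 / (g / real K) ^ 2"
    using V gK by (intro divide_left_mono power_mono mult_pos_pos zero_less_power) auto
  finally have W: "(\<Prod>p\<in>P. 1 + 2 / real p) \<le> real K ^ 2 / g ^ 2" by (simp add: power_divide)
  have "(1 + real (card P)) ^ (2 * K + 1) \<le> exp (real K + 1) ^ (2 * K + 1)"
  proof (rule power_mono)
    have "real (card P) \<le> exp (real K)" unfolding P_def by (rule card_primes_le) simp
    moreover have "1 + exp (real K) \<le> 2 * exp (real K)" by simp
    moreover have "exp (real K) * 2 \<le> exp (real K) * exp 1"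
      using exp_ge_add_one_self[of 1] by (intro mult_left_mono) auto
    ultimately show "1 + real (card P) \<le> exp (real K + 1)" 
      unfolding exp_add by linarith
  qed simp
  also have "\<dots> = exp ((real K + 1) * (2 * real K + 1))"
    by (simp only: exp_of_nat_mult[symmetric]) (simp add: mult.commute)
  finally have E: "(1 + real (card P)) ^ (2 * K + 1) \<le> exp ((real K + 1) * (2 * real K + 1))" .
  have "real N * (g / real K - real K ^ 2 / (g ^ 2 * 2 ^ (2 * K + 2))) \<le>
      real N * (V - (\<Prod>p\<in>P. 1 + 2 / real p) / 2 ^ Suc (2 * K + 1))"
  proof (intro mult_left_mono diff_mono V)
    have "(\<Prod>p\<in>P. 1 + 2 / real p) / 2 ^ Suc (2 * K + 1) \<le> (real K ^ 2 / g ^ 2) / 2 ^ Suc (2 * K + 1)"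
      by (intro divide_right_mono W) simp
    then show "(\<Prod>p\<in>P. 1 + 2 / real p) / 2 ^ Suc (2 * K + 1) \<le> real K ^ 2 / (g ^ 2 * 2 ^ (2 * K + 2))"
      by simp
  qed simp
  moreover have "real N * (V - (\<Prod>p\<in>P. 1 + 2 / real p) / 2 ^ Suc (2 * K + 1))
      - (1 + real (card P)) ^ (2 * K + 1) \<le> real (card R)"
    unfolding V_def R_def by (rule brun_pure_sieve) (auto simp: P_def, auto simp: primes_le_def)
  ultimately show ?thesis using card_le B_le E unfolding N_def[symmetric] C_def[symmetric] by linarith
qed

theorem mainTheorem1:
  "\<exists>\<epsilon> :: real \<Rightarrow> real. (\<epsilon> \<longlongrightarrow> 0) at_top \<and>
     (\<forall>\<^sub>F x :: real in at_top.
        real (card {n :: nat. real n \<le> x \<and> n \<ge> 3 \<and> mondrian_M n \<noteq> 0})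
          \<ge> (exp (- euler_mascheroni) / 2 + \<epsilon> x) * (x / ln (ln x)))"
proof -
  obtain e where e: "e \<longlonglongrightarrow> 0" and mertens: "\<And>M. M > 0 \<Longrightarrow>
      (\<Prod>p\<in>primes_le (exp (real M)). 1 - 1 / real p) \<ge> exp (- euler_mascheroni - e M) / real M"
    using mertens_third_lower by blast
  define c :: real where "c = exp (- euler_mascheroni)"
  define g where "g = (\<lambda>M. exp (- euler_mascheroni - e M))"
  have "g \<longlonglongrightarrow> exp (- euler_mascheroni - 0)" unfolding g_def by (intro tendsto_intros e)
  then have g: "g \<longlonglongrightarrow> c" by (simp add: c_def)
  define w where "w = (\<lambda>x::real. ln (ln x))"
  \<comment> \<open>Chosen so that exp(L) = (ln x lnln x)^2. One factor (ln x)^2 cancels the mean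
    value of the divisor count, and the rest makes the exceptional set o(x / lnln x).\<close>
  define L where "L = (\<lambda>x. 2 * w x + 2 * ln (w x))"
  define K where "K = (\<lambda>x. nat \<lceil>L x\<rceil>)"
  have w_top: "filterlim w at_top at_top" unfolding w_def by real_asymp
  have L_top: "filterlim L at_top at_top" unfolding L_def w_def by real_asymp
  have L_pos: "eventually (\<lambda>x. L x > 0) at_top" using L_top by (simp add: filterlim_at_top_dense)
  have w_pos: "eventually (\<lambda>x. w x > 0) at_top" using w_top by (simp add: filterlim_at_top_dense)
  have K_ge: "real (K x) \<ge> L x" for x by (simp add: K_def) linarith
  have K_le: "real (K x) \<le> L x + 1" if "L x > 0" for x using that by (simp add: K_def)
  have K_top: "filterlim K sequentially at_top"
    unfolding filterlim_at_top
  proof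
    fix M :: nat
    have "eventually (\<lambda>x. real M \<le> L x) at_top" using L_top by (simp add: filterlim_at_top)
    then show "eventually (\<lambda>x. M \<le> K x) at_top"
      by eventually_elim (use K_ge order_trans of_nat_le_iff in blast)
  qed
  \<comment> \<open>The three error terms divided by x / w. The first uses K <= L + 1, and its
    exponential is exp(O((lnln x)^2)), a power x^o(1).\<close>
  define T where "T = (\<lambda>x. exp ((L x + 2) * (2 * L x + 3)) * w x / x + 2 * w x / x
      + (1 + ln x) ^ 2 / (ln x) ^ 2 / w x)"
  have T: "(T \<longlongrightarrow> 0) at_top" unfolding T_def L_def w_def by real_asymp
  have N_lim: "((\<lambda>x. real (nat \<lfloor>x\<rfloor>) / x) \<longlongrightarrow> 1) at_top"
  proof (rule tendsto_sandwich)
    show "((\<lambda>x::real. (x - 1) / x) \<longlongrightarrow> 1) at_top" by real_asymp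
    show "eventually (\<lambda>x. (x - 1) / x \<le> real (nat \<lfloor>x\<rfloor>) / x) at_top"
      using eventually_gt_at_top[of 1]
    proof eventually_elim
      case (elim x)
      show ?case by (rule divide_right_mono) (use elim in linarith)+
    qed
    show "eventually (\<lambda>x. real (nat \<lfloor>x\<rfloor>) / x \<le> 1) at_top"
      using eventually_gt_at_top[of 1]
    proof eventually_elim
      case (elim x)
      then have "real (nat \<lfloor>x\<rfloor>) \<le> x" by linarith
      then show ?case using elim by simp
    qed
  qed (rule tendsto_const)
  \<comment> \<open>The factor 1/2 of the theorem arises here: K is asymptotic to 2 lnln x because
    the sieve limit is about the square of ln x.\<close>
  have wK_lim: "((\<lambda>x. w x / real (K x)) \<longlongrightarrow> 1 / 2) at_top"
  proof (rule tendsto_sandwich)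
    show "((\<lambda>x. w x / (L x + 1)) \<longlongrightarrow> 1 / 2) at_top" unfolding L_def w_def by real_asymp
    show "((\<lambda>x. w x / L x) \<longlongrightarrow> 1 / 2) at_top" unfolding L_def w_def by real_asymp
    show "eventually (\<lambda>x. w x / (L x + 1) \<le> w x / real (K x)) at_top"
      using L_pos w_pos
    proof eventually_elim
      case (elim x)
      then show ?case using K_ge[of x] K_le[of x] by (intro divide_left_mono mult_pos_pos) auto
    qed
    show "eventually (\<lambda>x. w x / real (K x) \<le> w x / L x) at_top"
      using L_pos w_pos
    proof eventually_elim
      case (elim x)
      then show ?case using K_ge[of x] by (intro divide_left_mono mult_pos_pos) auto
    qed
  qed
  \<comment> \<open>K times the bracket of the main term in \<open>card_mondrian_M_ne_0_ge\<close>;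
    the Rankin part decays exponentially, so only the limit \<open>c\<close> of \<open>g\<close>
    remains.\<close>
  define r where "r = (\<lambda>M. g M - real M ^ 3 / 2 ^ (2 * M + 2) / g M ^ 2)"
  have "(\<lambda>M. real M ^ 3 / 2 ^ (2 * M + 2)) \<longlonglongrightarrow> 0" by real_asymp
  then have "r \<longlonglongrightarrow> c - 0 / c ^ 2"
    unfolding r_def by (intro tendsto_intros g) (auto simp: c_def)
  then have r: "r \<longlonglongrightarrow> c" by simp
  define F where "F = (\<lambda>x. (real (nat \<lfloor>x\<rfloor>) / x) * (w x / real (K x)) * r (K x) - T x)"
  have "(F \<longlongrightarrow> 1 * (1 / 2) * c - 0) at_top"
    unfolding F_def by (intro tendsto_intros N_lim wK_lim T filterlim_compose[OF r K_top])
  then have F: "((\<lambda>x. F x - c / 2) \<longlongrightarrow> 0) at_top"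
    using LIM_zero[of F "c / 2" at_top] by simp
  have "eventually (\<lambda>x. real (card {n. real n \<le> x \<and> n \<ge> 3 \<and> mondrian_M n \<noteq> 0}) \<ge>
      F x * (x / w x)) at_top"
    using L_pos w_pos eventually_gt_at_top[of "exp 1"]
  proof eventually_elim
    case (elim x)
    have x: "x > 1" using elim(3) exp_ge_add_one_self[of 1] by linarith
    have lnx: "ln x > 0" using x by simp
    have Kpos: "K x > 0" using K_ge[of x] elim(1) by (intro Nat.gr0I) auto
    have g_pos: "g (K x) > 0" by (simp add: g_def)
    have "exp (real (K x)) \<ge> exp (L x)" using K_ge[of x] by simp
    moreover have "exp (L x) = ln x ^ 2 * w x ^ 2"
    proof -
      have "exp (L x) = exp (w x) ^ 2 * exp (ln (w x)) ^ 2"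
        by (simp add: L_def exp_add flip: exp_of_nat_mult)
      then show ?thesis using elim(2) lnx by (simp add: w_def)
    qed
    ultimately have expK: "exp (real (K x)) \<ge> ln x ^ 2 * w x ^ 2" by simp
    have "x * (1 + ln x) ^ 2 / exp (real (K x)) \<le> x * (1 + ln x) ^ 2 / (ln x ^ 2 * w x ^ 2)"
      using expK x lnx elim(2) by (intro divide_left_mono mult_nonneg_nonneg) auto
    also have "\<dots> = (1 + ln x) ^ 2 / (ln x) ^ 2 / w x * (x / w x)"
      by (simp add: power2_eq_square mult_ac)
    finally have t3: "x * (1 + ln x) ^ 2 / exp (real (K x)) \<le>
      (1 + ln x) ^ 2 / (ln x) ^ 2 / w x * (x / w x)" .
    have "exp ((real (K x) + 1) * (2 * real (K x) + 1)) \<le> exp ((L x + 2) * (2 * L x + 3))"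
      using K_le[OF elim(1)] elim(1) by (subst exp_le_cancel_iff, intro mult_mono) auto
    also have "\<dots> = exp ((L x + 2) * (2 * L x + 3)) * w x / x * (x / w x)"
      using x elim(2) by simp
    finally have t1: "exp ((real (K x) + 1) * (2 * real (K x) + 1)) \<le>
      exp ((L x + 2) * (2 * L x + 3)) * w x / x * (x / w x)" .
    have t2: "2 = 2 * w x / x * (x / w x)" using x elim(2) by simp
    have main: "(real (nat \<lfloor>x\<rfloor>) / x) * (w x / real (K x)) * r (K x) * (x / w x) =
      real (nat \<lfloor>x\<rfloor>) * (g (K x) / real (K x) - real (K x) ^ 2 / (g (K x) ^ 2 * 2 ^ (2 * K x + 2)))"
    proof -
      have "r (K x) / real (K x) = g (K x) / real (K x) - real (K x) ^ 2 / (g (K x) ^ 2 * 2 ^ (2 * K x + 2))"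
        using Kpos by (simp add: r_def diff_divide_distrib power2_eq_square power3_eq_cube)
      moreover have "(real (nat \<lfloor>x\<rfloor>) / x) * (w x / real (K x)) * r (K x) * (x / w x) =
          real (nat \<lfloor>x\<rfloor>) * (r (K x) / real (K x))"
        using x elim(2) by simp
      ultimately show ?thesis by simp
    qed
    have "F x * (x / w x) =
        (real (nat \<lfloor>x\<rfloor>) / x) * (w x / real (K x)) * r (K x) * (x / w x) - T x * (x / w x)"
      by (simp only: F_def left_diff_distrib)
    also have "T x * (x / w x) = exp ((L x + 2) * (2 * L x + 3)) * w x / x * (x / w x) +
        2 * w x / x * (x / w x) + (1 + ln x) ^ 2 / (ln x) ^ 2 / w x * (x / w x)"
      unfolding T_def by (simp only: distrib_right)
    finally have "F x * (x / w x) \<le>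
      real (nat \<lfloor>x\<rfloor>) * (g (K x) / real (K x) - real (K x) ^ 2 / (g (K x) ^ 2 * 2 ^ (2 * K x + 2)))
      - exp ((real (K x) + 1) * (2 * real (K x) + 1)) - 2 - x * (1 + ln x) ^ 2 / exp (real (K x))"
      unfolding main using t1 t2 t3 by linarith
    also have "\<dots> \<le> real (card {n. real n \<le> x \<and> n \<ge> 3 \<and> mondrian_M n \<noteq> 0})"
      by (rule card_mondrian_M_ne_0_ge) (use x Kpos g_pos mertens in \<open>auto simp: g_def\<close>)
    finally show ?case .
  qed
  with F show ?thesis
    by (intro exI[of _ "\<lambda>x. F x - c / 2"]) (simp add: c_def w_def)
qed

end
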